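(* Let $A$ be a finite-dimensional associative $k$-algebra. The cohomology of the complex $(W_{nc}(A),d_W)$ is given by $$H^j(W_{nc}(A))=\begin{cases}k,& j=0,\\ 0,& j>0.\end{cases}$$
   Context: $k$ is an algebraically closed field of characteristic zero. Let $A^*$ be the $k$-linear dual of $A$, a coalgebra with comultiplication $\Delta:A^*\to A^*\otimes A^*$ dual to the multiplication of $A$; write $\Delta(\lambda)=\sum\lambda'\otimes\lambda''$. Put $W_{nc}(A)=T(A^*_+\oplus A^*_-)$, the (unital) tensor algebra over $k$, where $A^*_+$ and $A^*_-$ are two copies of $A^*$; for $\lambda\in A^*$ write $\lambda_\pm$ for its image in $A^*_\pm$. Grade $W_{nc}(A)$ by $\deg\lambda_-=1$, $\deg\lambda_+=2$. The differential $d_W$ is the degree $+1$ super-derivation of $W_{nc}(A)$ determined by $$d_W\lambda_-=\lambda_++\sum\lambda'_-\otimes\lambda''_-,\qquad d_W\lambda_+=\sum(\lambda'_-\otimes\lambda''_+-\lambda'_+\otimes\lambda''_-),$$ and it satisfies $d_W^2=0$. *)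

theory Defs
  imports
    "HOL-Computational_Algebra.Polynomial"
    "HOL-Library.Poly_Mapping"
    "HOL-Library.Function_Algebras"
    "HOL-Library.Product_Plus"
    "HOL-Algebra.QuotRing"
    "HOL-Algebra.Module"
    "HOL-Algebra.Elementary_Groups"
begin

section \<open>Finite-dimensional algebras and their duals\<close>

text \<open>Associativity comes from the class \<^class>\<open>ring\<close>, which requires no unit; unital algebras
  are a special case.\<close>

locale fin_dim_algebra = vector_space scale
  for scale :: "'k::field \<Rightarrow> 'a::ring \<Rightarrow> 'a" +
  assumes scale_mult_left: "scale c x * y = scale c (x * y)"
    and scale_mult_right: "x * scale c y = scale c (x * y)"
    and finite_dimensional: "\<exists>B. finite B \<and> span B = UNIV"

definition dual :: "('k::field \<Rightarrow> 'a::ring \<Rightarrow> 'a) \<Rightarrow> ('a \<Rightarrow> 'k) set"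
  where "dual scale = {l. Vector_Spaces.linear scale (*) l}"

text \<open>Sweedler notation: \<open>comult_repr scale l n f g\<close> says that
  \<open>\<Delta> l = (\<Sum>i<n. f i \<otimes> g i)\<close>. As \<open>\<Delta>\<close> is dual to the multiplication,
  this is an equality of bilinear forms on \<open>A\<close>, under the identification of \<open>A\<^sup>* \<otimes> A\<^sup>*\<close> with
  \<open>(A \<otimes> A)\<^sup>*\<close> that finite-dimensionality provides.\<close>

definition comult_repr ::
    "('k::field \<Rightarrow> 'a::ring \<Rightarrow> 'a) \<Rightarrow> ('a \<Rightarrow> 'k) \<Rightarrow> nat \<Rightarrow> (nat \<Rightarrow> 'a \<Rightarrow> 'k) \<Rightarrow> (nat \<Rightarrow> 'a \<Rightarrow> 'k) \<Rightarrow> bool"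
  where "comult_repr scale l n f g \<longleftrightarrow>
    (\<forall>i<n. f i \<in> dual scale \<and> g i \<in> dual scale) \<and>
    (\<forall>a b. l (a * b) = (\<Sum>i<n. f i a * g i b))"


section \<open>Tensor algebras\<close>

text \<open>With lists as the free monoid, \<^typ>\<open>'v list \<Rightarrow>\<^sub>0 'k\<close> is its monoid algebra, with the
  convolution product of \<^theory>\<open>HOL-Library.Poly_Mapping\<close>: the free associative unital algebra on
  the set of all elements of \<^typ>\<open>'v\<close>.\<close>

instantiation list :: (type) monoid_add
begin

definition zero_list :: "'a list" where "zero_list = []"
definition plus_list :: "'a list \<Rightarrow> 'a list \<Rightarrow> 'a list" where "plus_list = (@)"

instance by intro_classes (simp_all add: zero_list_def plus_list_def)

end

definition free_algebra :: "'v set \<Rightarrow> ('v list \<Rightarrow>\<^sub>0 'k::field) ring"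
  where "free_algebra V =
    \<lparr>carrier = {p. \<forall>w \<in> Poly_Mapping.keys p. set w \<subseteq> V},
     mult = (*), one = 1, zero = 0, add = (+)\<rparr>"

definition fgen :: "'v \<Rightarrow> ('v list \<Rightarrow>\<^sub>0 'k::field)"
  where "fgen v = Poly_Mapping.single [v] 1"

definition fconst :: "'k \<Rightarrow> ('v list \<Rightarrow>\<^sub>0 'k::field)"
  where "fconst c = Poly_Mapping.single [] c"

text \<open>The tensor algebra of a subspace \<open>V\<close> of a vector space with scalar multiplication \<open>sc\<close>: the
  free algebra on the set \<open>V\<close>, modulo the two-sided ideal that makes \<open>V \<rightarrow> T(V)\<close> linear.\<close>

definition tensor_ideal ::
    "('k::field \<Rightarrow> 'v::ab_group_add \<Rightarrow> 'v) \<Rightarrow> 'v set \<Rightarrow> ('v list \<Rightarrow>\<^sub>0 'k) set"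
  where "tensor_ideal sc V = genideal (free_algebra V)
    ({fgen (u + v) - (fgen u + fgen v) | u v. u \<in> V \<and> v \<in> V} \<union>
     {fgen (sc c v) - fconst c * fgen v | c v. v \<in> V})"

definition tensor_class ::
    "('k::field \<Rightarrow> 'v::ab_group_add \<Rightarrow> 'v) \<Rightarrow> 'v set \<Rightarrow> ('v list \<Rightarrow>\<^sub>0 'k) \<Rightarrow> ('v list \<Rightarrow>\<^sub>0 'k) set"
  where "tensor_class sc V p = tensor_ideal sc V +>\<^bsub>free_algebra V\<^esub> p"

definition tensor_algebra ::
    "('k::field \<Rightarrow> 'v::ab_group_add \<Rightarrow> 'v) \<Rightarrow> 'v set \<Rightarrow> ('k, ('v list \<Rightarrow>\<^sub>0 'k) set) module"
  where "tensor_algebra sc V =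
    (let T = free_algebra V Quot tensor_ideal sc V in
     \<lparr>carrier = carrier T, mult = mult T, one = one T, zero = zero T, add = add T,
      smult = (\<lambda>c X. mult T (tensor_class sc V (fconst c)) X)\<rparr>)"


section \<open>The noncommutative Weil algebra\<close>

type_synonym ('k, 'a) dual2 = "('a \<Rightarrow> 'k) \<times> ('a \<Rightarrow> 'k)"

text \<open>\<open>A\<^sup>*\<^sub>+ \<oplus> A\<^sup>*\<^sub>-\<close> as pairs, with \<open>A\<^sup>*\<^sub>+\<close> the first and \<open>A\<^sup>*\<^sub>-\<close> the second summand.\<close>

definition dual2_scale :: "'k::field \<Rightarrow> ('k, 'a) dual2 \<Rightarrow> ('k, 'a) dual2"
  where "dual2_scale c v = ((\<lambda>a. c * fst v a), (\<lambda>a. c * snd v a))"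

definition dual2 :: "('k::field \<Rightarrow> 'a::ring \<Rightarrow> 'a) \<Rightarrow> ('k, 'a) dual2 set"
  where "dual2 scale = dual scale \<times> dual scale"

type_synonym ('k, 'a) weil = "(('k, 'a) dual2 list \<Rightarrow>\<^sub>0 'k) set"

definition weil_algebra ::
    "('k::field \<Rightarrow> 'a::ring \<Rightarrow> 'a) \<Rightarrow> ('k, ('k, 'a) weil) module"
  where "weil_algebra scale = tensor_algebra dual2_scale (dual2 scale)"

datatype 'l weil_gen = Plus 'l | Minus 'l

primrec gen_vector :: "('a \<Rightarrow> 'k::field) weil_gen \<Rightarrow> ('k, 'a) dual2"
  where "gen_vector (Plus l) = (l, 0)"
  | "gen_vector (Minus l) = (0, l)"

primrec gen_functional :: "'l weil_gen \<Rightarrow> 'l"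
  where "gen_functional (Plus l) = l"
  | "gen_functional (Minus l) = l"

primrec gen_degree :: "'l weil_gen \<Rightarrow> nat"
  where "gen_degree (Plus l) = 2"
  | "gen_degree (Minus l) = 1"

definition weil_plus :: "('k::field \<Rightarrow> 'a::ring \<Rightarrow> 'a) \<Rightarrow> ('a \<Rightarrow> 'k) \<Rightarrow> ('k, 'a) weil"
  where "weil_plus scale l = tensor_class dual2_scale (dual2 scale) (fgen (gen_vector (Plus l)))"

definition weil_minus :: "('k::field \<Rightarrow> 'a::ring \<Rightarrow> 'a) \<Rightarrow> ('a \<Rightarrow> 'k) \<Rightarrow> ('k, 'a) weil"
  where "weil_minus scale l = tensor_class dual2_scale (dual2 scale) (fgen (gen_vector (Minus l)))"

text \<open>Words in the homogeneous generators \<open>\<lambda>\<^sub>+\<close> (degree 2) and \<open>\<lambda>\<^sub>-\<close> (degree 1) of total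
  degree \<open>j\<close>; the graded piece of degree \<open>j\<close> is the set of classes of their linear combinations.\<close>

definition weil_words :: "('k::field \<Rightarrow> 'a::ring \<Rightarrow> 'a) \<Rightarrow> nat \<Rightarrow> ('k, 'a) dual2 list set"
  where "weil_words scale j = {map gen_vector gs | gs.
    gen_functional ` set gs \<subseteq> dual scale \<and> sum_list (map gen_degree gs) = j}"

definition weil_degree :: "('k::field \<Rightarrow> 'a::ring \<Rightarrow> 'a) \<Rightarrow> nat \<Rightarrow> ('k, 'a) weil set"
  where "weil_degree scale j =
    tensor_class dual2_scale (dual2 scale) ` {p. Poly_Mapping.keys p \<subseteq> weil_words scale j}"

text \<open>Linearity, degree \<open>+1\<close>, the super-Leibniz rule (with left factor homogeneous) and the values on
  generators. Since \<open>W\<close> is a carrier set and not a type, \<open>d\<close> is taken extensional, so that these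
  conditions determine it as a function. The values on generators are prescribed for every Sweedler
  representation of \<open>\<Delta> l\<close>; one exists, and the sums do not depend on it.\<close>

definition is_weil_differential ::
    "('k::field \<Rightarrow> 'a::ring \<Rightarrow> 'a) \<Rightarrow> (('k, 'a) weil \<Rightarrow> ('k, 'a) weil) \<Rightarrow> bool"
  where "is_weil_differential scale d \<longleftrightarrow>
    (let W = weil_algebra scale; pl = weil_plus scale; mi = weil_minus scale in
      d \<in> carrier W \<rightarrow>\<^sub>E carrier W \<and>
      (\<forall>x\<in>carrier W. \<forall>y\<in>carrier W. d (x \<oplus>\<^bsub>W\<^esub> y) = d x \<oplus>\<^bsub>W\<^esub> d y) \<and>
      (\<forall>c. \<forall>x\<in>carrier W. d (c \<odot>\<^bsub>W\<^esub> x) = c \<odot>\<^bsub>W\<^esub> d x) \<and>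
      (\<forall>i. d ` weil_degree scale i \<subseteq> weil_degree scale (Suc i)) \<and>
      (\<forall>i. \<forall>x\<in>weil_degree scale i. \<forall>y\<in>carrier W.
         d (x \<otimes>\<^bsub>W\<^esub> y) = d x \<otimes>\<^bsub>W\<^esub> y \<oplus>\<^bsub>W\<^esub> ((-1) ^ i) \<odot>\<^bsub>W\<^esub> (x \<otimes>\<^bsub>W\<^esub> d y)) \<and>
      (\<forall>l\<in>dual scale. \<forall>n f g. comult_repr scale l n f g \<longrightarrow>
         d (mi l) = pl l \<oplus>\<^bsub>W\<^esub> (\<Oplus>\<^bsub>W\<^esub>i\<in>{..<n}. mi (f i) \<otimes>\<^bsub>W\<^esub> mi (g i)) \<and>
         d (pl l) = (\<Oplus>\<^bsub>W\<^esub>i\<in>{..<n}. mi (f i) \<otimes>\<^bsub>W\<^esub> pl (g i) \<ominus>\<^bsub>W\<^esub> pl (f i) \<otimes>\<^bsub>W\<^esub> mi (g i))))"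

definition weil_d :: "('k::field \<Rightarrow> 'a::ring \<Rightarrow> 'a) \<Rightarrow> ('k, 'a) weil \<Rightarrow> ('k, 'a) weil"
  where "weil_d scale = (THE d. is_weil_differential scale d)"


section \<open>Cohomology\<close>

definition weil_cocycles :: "('k::field \<Rightarrow> 'a::ring \<Rightarrow> 'a) \<Rightarrow> nat \<Rightarrow> ('k, 'a) weil set"
  where "weil_cocycles scale j =
    {x \<in> weil_degree scale j. weil_d scale x = \<zero>\<^bsub>weil_algebra scale\<^esub>}"

definition weil_coboundaries :: "('k::field \<Rightarrow> 'a::ring \<Rightarrow> 'a) \<Rightarrow> nat \<Rightarrow> ('k, 'a) weil set"
  where "weil_coboundaries scale j =
    (case j of 0 \<Rightarrow> {\<zero>\<^bsub>weil_algebra scale\<^esub>} | Suc i \<Rightarrow> weil_d scale ` weil_degree scale i)"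

text \<open>The vector space \<open>H\<^sup>j\<close> is the additive group \<open>weil_cohomology\<close> of cosets with the scalar
  multiplication \<open>weil_cohomology_smult\<close>, which sends \<open>B + z\<close> to \<open>B + c z\<close>.\<close>

definition weil_cohomology ::
    "('k::field \<Rightarrow> 'a::ring \<Rightarrow> 'a) \<Rightarrow> nat \<Rightarrow> ('k, 'a) weil set monoid"
  where "weil_cohomology scale j =
    add_monoid (weil_algebra scale \<lparr>carrier := weil_cocycles scale j\<rparr>)
      Mod weil_coboundaries scale j"

definition weil_cohomology_smult ::
    "('k::field \<Rightarrow> 'a::ring \<Rightarrow> 'a) \<Rightarrow> nat \<Rightarrow> 'k \<Rightarrow> ('k, 'a) weil set \<Rightarrow> ('k, 'a) weil set"
  where "weil_cohomology_smult scale j c X =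
    weil_coboundaries scale j <+>\<^bsub>weil_algebra scale\<^esub> (\<lambda>x. c \<odot>\<^bsub>weil_algebra scale\<^esub> x) ` X"

definition field_add_group :: "'k::field monoid"
  where "field_add_group = \<lparr>carrier = UNIV, mult = (+), one = 0\<rparr>"

end

theory Submission
  imports Defs
begin

text \<open>The point is to choose better generators. Put \<open>\<lambda>\<^sub>d = d \<lambda>\<^sub>- = \<lambda>\<^sub>+ + \<Sum> \<lambda>'\<^sub>- \<lambda>''\<^sub>-\<close>; then
  \<open>W\<close> is also freely generated by the \<open>\<lambda>\<^sub>-\<close> and the \<open>\<lambda>\<^sub>d\<close>, and in these generators the differential
  is \<open>d \<lambda>\<^sub>- = \<lambda>\<^sub>d\<close>, \<open>d \<lambda>\<^sub>d = 0\<close>. After the choice of a basis of \<open>A\<close> this becomes the free algebra on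
  letters \<open>x\<^sub>b\<close> of degree 1 and \<open>y\<^sub>b\<close> of degree 2 with the derivation \<open>x\<^sub>b \<mapsto> y\<^sub>b \<mapsto> 0\<close>, called the
  model below.

  The model is contracted onto the constants by the linear map \<open>h\<close> that vanishes on the empty
  word and on words that begin with some \<open>x\<^sub>b\<close>, and sends \<open>y\<^sub>b w\<close> to \<open>x\<^sub>b w\<close>. Indeed
  \<open>d h (y\<^sub>b w) = y\<^sub>b w - x\<^sub>b d w\<close> and \<open>h d (y\<^sub>b w) = x\<^sub>b d w\<close>, while \<open>d h (x\<^sub>b w) = 0\<close> and
  \<open>h d (x\<^sub>b w) = h (y\<^sub>b w - x\<^sub>b d w) = x\<^sub>b w\<close>, so that \<open>d h + h d\<close> is the identity on nonempty words
  (\<open>model_homotopy\<close>). Unlike the derivation with \<open>y\<^sub>b \<mapsto> x\<^sub>b \<mapsto> 0\<close>, for which \<open>d h + h d\<close>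
  multiplies a word by its length, this homotopy involves no division.

  The remaining work is the transport to \<open>W\<close>. The algebra isomorphism \<open>weil_of\<close> from the model
  onto \<open>W\<close> is built from a pair of homomorphisms \<open>from_model\<close> and \<open>to_model\<close> between free algebras,
  which are mutually inverse modulo the ideal that defines the tensor algebra; it respects the
  gradings (\<open>weil_degree_eq\<close>). The transported differential satisfies the defining conditions of
  \<open>d\<^sub>W\<close>: the formula for \<open>d \<lambda>\<^sub>+\<close> amounts to coassociativity, that is, to the associativity of \<open>A\<close>
  (\<open>comult_repr_cubic_x\<close>). As a derivation is determined on generators, it is \<open>d\<^sub>W\<close>
  (\<open>is_weil_differential_unique\<close>).\<close>


section \<open>Free associative algebras\<close>

lemma single_mult_single:
  "Poly_Mapping.single u a * Poly_Mapping.single v b = Poly_Mapping.single (u @ v) (a * b)"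
  by (simp add: mult_single plus_list_def)

lemma fconst_0 [simp]: "fconst 0 = 0"
  by (simp add: fconst_def)

lemma fconst_1 [simp]: "fconst 1 = 1"
  by (simp add: fconst_def flip: zero_list_def)

lemma fconst_add: "fconst (a + b) = fconst a + fconst b"
  by (simp add: fconst_def single_add)

lemma fconst_uminus: "fconst (- a) = - fconst a"
  by (simp add: fconst_def single_uminus)

lemma fconst_mult: "fconst (a * b) = fconst a * fconst b"
  by (simp add: fconst_def single_mult_single)

lemma fconst_sum: "fconst (sum f I) = (\<Sum>i\<in>I. fconst (f i))"
  by (induction I rule: infinite_finite_induct) (simp_all add: fconst_add)

lemma fconst_mult_single: "fconst c * Poly_Mapping.single w a = Poly_Mapping.single w (c * a)"
  by (simp add: fconst_def single_mult_single)

lemma fgen_mult_single: "fgen v * Poly_Mapping.single w c = Poly_Mapping.single (v # w) c"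
  by (simp add: fgen_def single_mult_single)

lemma lookup_fconst_mult: "Poly_Mapping.lookup (fconst c * p) w = c * Poly_Mapping.lookup p w"
proof -
  have "fconst c * p = Poly_Mapping.map ((*) c) p"
    by (simp add: mult_map_scale_conv_mult fconst_def zero_list_def)
  then show ?thesis
    by (simp add: map.rep_eq when_def)
qed

text \<open>The linear combinations of a set of words.\<close>

definition word_span :: "'v list set \<Rightarrow> ('v list \<Rightarrow>\<^sub>0 'k::field) set"
  where "word_span S = {p. Poly_Mapping.keys p \<subseteq> S}"

lemma in_word_span_UNIV [simp]: "p \<in> word_span UNIV"
  by (simp add: word_span_def)

lemma word_span_0 [simp]: "0 \<in> word_span S"
  by (simp add: word_span_def)

lemma word_span_add: "p \<in> word_span S \<Longrightarrow> q \<in> word_span S \<Longrightarrow> p + q \<in> word_span S"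
  using Poly_Mapping.keys_add[of p q] by (auto simp: word_span_def)

lemma word_span_fconst_mult: "p \<in> word_span S \<Longrightarrow> fconst c * p \<in> word_span S"
  by (auto simp: word_span_def in_keys_iff lookup_fconst_mult)

lemma word_span_uminus: "p \<in> word_span S \<Longrightarrow> - p \<in> word_span S"
  by (auto simp: word_span_def in_keys_iff)

lemma word_span_diff: "p \<in> word_span S \<Longrightarrow> q \<in> word_span S \<Longrightarrow> p - q \<in> word_span S"
  using word_span_add[of p S "- q"] word_span_uminus[of q S] by simp

lemma word_span_sum: "(\<And>i. i \<in> I \<Longrightarrow> f i \<in> word_span S) \<Longrightarrow> sum f I \<in> word_span S"
  by (induction I rule: infinite_finite_induct) (simp_all add: word_span_add)

lemma word_span_single: "w \<in> S \<Longrightarrow> Poly_Mapping.single w c \<in> word_span S"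
  by (simp add: word_span_def)

lemma word_span_mono: "S \<subseteq> T \<Longrightarrow> p \<in> word_span S \<Longrightarrow> p \<in> word_span T"
  by (auto simp: word_span_def)

lemma poly_mapping_eq_sum_single:
  "p = (\<Sum>w\<in>Poly_Mapping.keys p. Poly_Mapping.single w (Poly_Mapping.lookup p w))"
  by (rule poly_mapping_eqI) (simp add: lookup_sum lookup_single when_def in_keys_iff)

lemma word_span_induct [consumes 1, case_names zero single add]:
  assumes p: "p \<in> word_span S"
    and zero: "P 0"
    and single: "\<And>w c. w \<in> S \<Longrightarrow> P (Poly_Mapping.single w c)"
    and add: "\<And>p q. p \<in> word_span S \<Longrightarrow> q \<in> word_span S \<Longrightarrow> P p \<Longrightarrow> P q \<Longrightarrow> P (p + q)"
  shows "P p"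
proof -
  have "finite I \<Longrightarrow> I \<subseteq> Poly_Mapping.keys p \<Longrightarrow>
      P (\<Sum>w\<in>I. Poly_Mapping.single w (Poly_Mapping.lookup p w)) \<and>
      (\<Sum>w\<in>I. Poly_Mapping.single w (Poly_Mapping.lookup p w)) \<in> word_span S" for I
  proof (induction I rule: finite_induct)
    case (insert w I)
    then have "w \<in> S"
      using p by (auto simp: word_span_def)
    with insert show ?case
      by (auto intro!: add single word_span_add word_span_single)
  qed (simp add: zero)
  from this[of "Poly_Mapping.keys p"] show ?thesis
    using poly_mapping_eq_sum_single[of p] by simp
qed

lemmas free_algebra_induct [case_names zero single add] =
  word_span_induct[OF in_word_span_UNIV]

lemma word_span_mult:
  assumes p: "p \<in> word_span S" and q: "q \<in> word_span T"
    and ST: "\<And>u v. u \<in> S \<Longrightarrow> v \<in> T \<Longrightarrow> u @ v \<in> U"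
  shows "p * q \<in> word_span U"
  using p
proof (induction rule: word_span_induct)
  case (single u a)
  show ?case
    using q
    by (induction rule: word_span_induct)
      (auto simp: distrib_left single_mult_single intro!: word_span_add word_span_single ST single)
qed (auto simp: distrib_right intro: word_span_add)

lemma fconst_mult_commute: "p * fconst c = fconst c * p"
proof (induction p rule: free_algebra_induct)
  case (single w a)
  then show ?case
    by (simp add: fconst_def single_mult_single mult.commute)
qed (simp_all add: algebra_simps)

lemma mult_fconst_left_commute: "p * (fconst c * q) = fconst c * (p * q)"
  by (metis fconst_mult_commute mult.assoc)

text \<open>The linear extension of a map on words.\<close>

definition lin_ext ::
    "('v list \<Rightarrow> ('u list \<Rightarrow>\<^sub>0 'k)) \<Rightarrow> ('v list \<Rightarrow>\<^sub>0 'k::field) \<Rightarrow> ('u list \<Rightarrow>\<^sub>0 'k)"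
  where "lin_ext f p = (\<Sum>w\<in>Poly_Mapping.keys p. fconst (Poly_Mapping.lookup p w) * f w)"

lemma lin_ext_superset:
  assumes "finite I" "Poly_Mapping.keys p \<subseteq> I"
  shows "lin_ext f p = (\<Sum>w\<in>I. fconst (Poly_Mapping.lookup p w) * f w)"
  unfolding lin_ext_def
  by (rule sum.mono_neutral_left) (use assms in \<open>auto simp: in_keys_iff\<close>)

lemma lin_ext_0 [simp]: "lin_ext f 0 = 0"
  by (simp add: lin_ext_def)

lemma lin_ext_single: "lin_ext f (Poly_Mapping.single w c) = fconst c * f w"
  by (simp add: lin_ext_def)

lemma lin_ext_add: "lin_ext f (p + q) = lin_ext f p + lin_ext f q"
proof -
  let ?I = "Poly_Mapping.keys p \<union> Poly_Mapping.keys q"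
  have "lin_ext f (p + q) = (\<Sum>w\<in>?I. fconst (Poly_Mapping.lookup (p + q) w) * f w)"
    by (intro lin_ext_superset Poly_Mapping.keys_add) simp
  also have "\<dots> = lin_ext f p + lin_ext f q"
    by (simp add: lin_ext_superset[of ?I p] lin_ext_superset[of ?I q] lookup_add fconst_add
        distrib_right sum.distrib)
  finally show ?thesis .
qed

lemma lin_ext_fconst_mult: "lin_ext f (fconst c * p) = fconst c * lin_ext f p"
proof (induction p rule: free_algebra_induct)
  case (single w a)
  then show ?case
    by (simp add: fconst_mult_single lin_ext_single fconst_mult mult.assoc)
qed (simp_all add: distrib_left lin_ext_add)

lemma lin_ext_uminus: "lin_ext f (- p) = - lin_ext f p"
  using lin_ext_fconst_mult[of f "-1" p] by (simp add: fconst_uminus)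

lemma lin_ext_diff: "lin_ext f (p - q) = lin_ext f p - lin_ext f q"
  using lin_ext_add[of f p "- q"] by (simp add: lin_ext_uminus)

lemma lin_ext_sum: "lin_ext f (sum p I) = (\<Sum>i\<in>I. lin_ext f (p i))"
  by (induction I rule: infinite_finite_induct) (simp_all add: lin_ext_add)

lemma lin_ext_word_span:
  assumes "p \<in> word_span S" "\<And>w. w \<in> S \<Longrightarrow> f w \<in> word_span T"
  shows "lin_ext f p \<in> word_span T"
  using assms(1)
  by (induction rule: word_span_induct)
    (auto simp: lin_ext_single lin_ext_add intro: word_span_add word_span_fconst_mult assms(2))

text \<open>The algebra homomorphism with given values on the generators.\<close>

definition alg_ext :: "('v \<Rightarrow> ('u list \<Rightarrow>\<^sub>0 'k)) \<Rightarrow> ('v list \<Rightarrow>\<^sub>0 'k::field) \<Rightarrow> ('u list \<Rightarrow>\<^sub>0 'k)"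
  where "alg_ext f = lin_ext (\<lambda>w. prod_list (map f w))"

lemma alg_ext_0 [simp]: "alg_ext f 0 = 0"
  by (simp add: alg_ext_def)

lemma alg_ext_add: "alg_ext f (p + q) = alg_ext f p + alg_ext f q"
  by (simp add: alg_ext_def lin_ext_add)

lemma alg_ext_diff: "alg_ext f (p - q) = alg_ext f p - alg_ext f q"
  by (simp add: alg_ext_def lin_ext_diff)

lemma alg_ext_uminus: "alg_ext f (- p) = - alg_ext f p"
  by (simp add: alg_ext_def lin_ext_uminus)

lemma alg_ext_sum: "alg_ext f (sum p I) = (\<Sum>i\<in>I. alg_ext f (p i))"
  by (simp add: alg_ext_def lin_ext_sum)

lemma alg_ext_fconst_mult: "alg_ext f (fconst c * p) = fconst c * alg_ext f p"
  by (simp add: alg_ext_def lin_ext_fconst_mult)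

lemma alg_ext_1 [simp]: "alg_ext f 1 = 1"
  using lin_ext_single[of "\<lambda>w. prod_list (map f w)" "[]" 1]
  by (simp add: alg_ext_def flip: zero_list_def) (simp add: zero_list_def)

lemma alg_ext_fconst [simp]: "alg_ext f (fconst c) = fconst c"
  using alg_ext_fconst_mult[of f c 1] by simp

lemma alg_ext_fgen [simp]: "alg_ext f (fgen v) = f v"
  by (simp add: alg_ext_def fgen_def lin_ext_single)

lemma alg_ext_mult: "alg_ext f (p * q) = alg_ext f p * alg_ext f q"
proof (induction p rule: free_algebra_induct)
  case (single u a)
  show ?case
  proof (induction q rule: free_algebra_induct)
    case (single v b)
    show ?case
      using mult_fconst_left_commute[of "prod_list (map f u)" b "prod_list (map f v)"]
      by (simp add: single_mult_single alg_ext_def lin_ext_single fconst_mult mult.assoc)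
  qed (simp_all add: distrib_left alg_ext_add)
qed (simp_all add: distrib_right alg_ext_add)

lemma carrier_free_algebra: "carrier (free_algebra V) = word_span (lists V)"
  by (auto simp: free_algebra_def word_span_def)

lemma free_algebra_simps [simp]:
  "mult (free_algebra V) = (*)" "one (free_algebra V) = 1"
  "zero (free_algebra V) = 0" "add (free_algebra V) = (+)"
  by (simp_all add: free_algebra_def)

lemma one_in_word_span: "[] \<in> S \<Longrightarrow> 1 \<in> word_span S"
  using word_span_single[of "[]" S 1] by (simp flip: zero_list_def)

lemma fgen_in_word_span: "[v] \<in> S \<Longrightarrow> fgen v \<in> word_span S"
  by (simp add: fgen_def word_span_single)

lemma fconst_in_word_span: "[] \<in> S \<Longrightarrow> fconst c \<in> word_span S"
  by (simp add: fconst_def word_span_single)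

lemma word_span_lists_mult:
  "p \<in> word_span (lists V) \<Longrightarrow> q \<in> word_span (lists V) \<Longrightarrow> p * q \<in> word_span (lists V)"
  by (erule word_span_mult) auto

lemma prod_list_in_word_span:
  assumes Nil: "[] \<in> S 0" and append: "\<And>i j u v. u \<in> S i \<Longrightarrow> v \<in> S j \<Longrightarrow> u @ v \<in> S (i + j)"
    and f: "\<And>g. g \<in> set w \<Longrightarrow> f g \<in> word_span (S (deg g))"
  shows "prod_list (map f w) \<in> word_span (S (sum_list (map deg w :: nat list)))"
  using f
proof (induction w)
  case (Cons g w)
  then show ?case
    by (auto intro: word_span_mult append)
qed (simp add: one_in_word_span Nil)

lemma alg_ext_in_word_span:
  assumes "p \<in> word_span (lists U)" "\<And>g. g \<in> U \<Longrightarrow> f g \<in> word_span (lists V)"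
  shows "alg_ext f p \<in> word_span (lists V)"
  unfolding alg_ext_def using assms(1)
proof (rule lin_ext_word_span)
  fix w assume "w \<in> lists U"
  then show "prod_list (map f w) \<in> word_span (lists V)"
    by (induction w) (auto intro: word_span_lists_mult one_in_word_span assms(2))
qed

lemma ring_free_algebra:
  fixes V :: "'v set"
  shows "ring (free_algebra V :: ('v list \<Rightarrow>\<^sub>0 'k::field) ring)"
proof (rule ringI)
  show "abelian_group (free_algebra V :: ('v list \<Rightarrow>\<^sub>0 'k::field) ring)"
  proof (rule abelian_groupI)
    fix p :: "'v list \<Rightarrow>\<^sub>0 'k"
    assume "p \<in> carrier (free_algebra V)"
    then show "\<exists>q\<in>carrier (free_algebra V). q \<oplus>\<^bsub>free_algebra V\<^esub> p = \<zero>\<^bsub>free_algebra V\<^esub>"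
      by (intro bexI[of _ "- p"]) (auto simp: carrier_free_algebra word_span_uminus)
  qed (auto simp: carrier_free_algebra word_span_add add_ac)
  show "monoid (free_algebra V :: ('v list \<Rightarrow>\<^sub>0 'k::field) ring)"
    by standard (auto simp: carrier_free_algebra one_in_word_span word_span_lists_mult mult.assoc)
qed (auto simp: carrier_free_algebra distrib_left distrib_right)


section \<open>The contractible model\<close>

text \<open>With \<open>x\<^sub>b = Minus b\<close> of degree 1 and \<open>y\<^sub>b = Plus b\<close> of degree 2, the derivation \<open>d x\<^sub>b = y\<^sub>b\<close>,
  \<open>d y\<^sub>b = 0\<close> of the free algebra on all \<open>x\<^sub>b\<close> and \<open>y\<^sub>b\<close>.\<close>

abbreviation gen_x :: "'b \<Rightarrow> ('b weil_gen list \<Rightarrow>\<^sub>0 'k::field)"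
  where "gen_x b \<equiv> fgen (Minus b)"

abbreviation gen_y :: "'b \<Rightarrow> ('b weil_gen list \<Rightarrow>\<^sub>0 'k::field)"
  where "gen_y b \<equiv> fgen (Plus b)"

text \<open>The recursion on words is the super-Leibniz rule with a single letter as left factor.\<close>

fun model_d_word :: "'b weil_gen list \<Rightarrow> ('b weil_gen list \<Rightarrow>\<^sub>0 'k::field)"
  where "model_d_word [] = 0"
  | "model_d_word (Minus b # w) = Poly_Mapping.single (Plus b # w) 1 - gen_x b * model_d_word w"
  | "model_d_word (Plus b # w) = gen_y b * model_d_word w"

definition model_d :: "('b weil_gen list \<Rightarrow>\<^sub>0 'k::field) \<Rightarrow> ('b weil_gen list \<Rightarrow>\<^sub>0 'k)"
  where "model_d = lin_ext model_d_word"

text \<open>The contracting homotopy changes only the first letter of a word; it is not a derivation.\<close>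

fun homotopy_word :: "'b weil_gen list \<Rightarrow> ('b weil_gen list \<Rightarrow>\<^sub>0 'k::field)"
  where "homotopy_word [] = 0"
  | "homotopy_word (Minus b # w) = 0"
  | "homotopy_word (Plus b # w) = Poly_Mapping.single (Minus b # w) 1"

definition homotopy :: "('b weil_gen list \<Rightarrow>\<^sub>0 'k::field) \<Rightarrow> ('b weil_gen list \<Rightarrow>\<^sub>0 'k)"
  where "homotopy = lin_ext homotopy_word"

lemma model_d_0 [simp]: "model_d 0 = 0"
  and model_d_add: "model_d (p + q) = model_d p + model_d q"
  and model_d_diff: "model_d (p - q) = model_d p - model_d q"
  and model_d_sum: "model_d (sum f I) = (\<Sum>i\<in>I. model_d (f i))"
  and model_d_fconst_mult: "model_d (fconst c * p) = fconst c * model_d p"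
  by (simp_all add: model_d_def lin_ext_add lin_ext_diff lin_ext_sum lin_ext_fconst_mult)

lemma homotopy_0 [simp]: "homotopy 0 = 0"
  and homotopy_add: "homotopy (p + q) = homotopy p + homotopy q"
  and homotopy_diff: "homotopy (p - q) = homotopy p - homotopy q"
  by (simp_all add: homotopy_def lin_ext_add lin_ext_diff)

lemma model_d_fconst [simp]: "model_d (fconst c) = 0"
  by (simp add: model_d_def fconst_def lin_ext_single)

lemma model_d_x_mult: "model_d (gen_x b * p) = gen_y b * p - gen_x b * model_d p"
proof (induction p rule: free_algebra_induct)
  case (single w c)
  show ?case
    by (simp add: fgen_mult_single model_d_def lin_ext_single right_diff_distrib
        fconst_mult_single mult_fconst_left_commute)
qed (simp_all add: distrib_left model_d_add)

lemma model_d_y_mult: "model_d (gen_y b * p) = gen_y b * model_d p"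
proof (induction p rule: free_algebra_induct)
  case (single w c)
  show ?case
    by (simp add: fgen_mult_single model_d_def lin_ext_single mult_fconst_left_commute)
qed (simp_all add: distrib_left model_d_add)

lemma model_d_1 [simp]: "model_d 1 = 0"
  using model_d_fconst[of 1] by simp

lemma model_d_x [simp]: "model_d (gen_x b) = gen_y b"
  using model_d_x_mult[of b 1] by simp

lemma model_d_y [simp]: "model_d (gen_y b) = 0"
  using model_d_y_mult[of b 1] by simp

lemma homotopy_x_mult: "homotopy (gen_x b * p) = 0"
proof (induction p rule: free_algebra_induct)
  case (single w c)
  show ?case
    by (simp add: fgen_mult_single homotopy_def lin_ext_single)
qed (simp_all add: distrib_left homotopy_add)

lemma homotopy_y_mult: "homotopy (gen_y b * p) = gen_x b * p"
proof (induction p rule: free_algebra_induct)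
  case (single w c)
  show ?case
    by (simp add: fgen_mult_single homotopy_def lin_ext_single fconst_mult_single)
qed (simp_all add: distrib_left homotopy_add)

lemma gen_word_cases:
  obtains (Nil) "w = []" | (x) b v where "w = Minus b # v" | (y) b v where "w = Plus b # v"
  by (cases w; metis weil_gen.exhaust)

lemma model_d_model_d: "model_d (model_d p) = 0"
proof (induction p rule: free_algebra_induct)
  case (single w c)
  show ?case
  proof (induction w)
    case Nil
    then show ?case
      by (simp add: model_d_def lin_ext_single)
  next
    case (Cons g w)
    then show ?case
      by (cases g) (simp_all add: model_d_x_mult model_d_y_mult model_d_diff flip: fgen_mult_single)
  qed
qed (simp_all add: model_d_add)

text \<open>The homotopy contracts the model onto the constants.\<close>

lemma model_homotopy:
  "model_d (homotopy p) + homotopy (model_d p) = p - fconst (Poly_Mapping.lookup p [])"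
proof (induction p rule: free_algebra_induct)
  case (single w c)
  show ?case
  proof (cases w)
    case Nil
    then show ?thesis
      by (simp add: homotopy_def model_d_def lin_ext_single fconst_def)
  next
    case (Cons g v)
    then show ?thesis
      by (cases g)
        (simp_all add: model_d_x_mult model_d_y_mult homotopy_x_mult homotopy_y_mult homotopy_diff
          lookup_single flip: fgen_mult_single, simp_all add: fgen_mult_single lookup_single)
  qed
next
  case (add p q)
  from arg_cong2[where f = "(+)", OF add.IH] show ?case
    by (simp add: model_d_add homotopy_add lookup_add fconst_add algebra_simps)
qed simp

text \<open>The letters \<open>x\<^sub>b\<close> and \<open>y\<^sub>b\<close> for \<open>b\<close> in a set \<open>B\<close>, and the words in them of total degree \<open>j\<close>.\<close>

definition letters :: "'b set \<Rightarrow> 'b weil_gen set"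
  where "letters B = Plus ` B \<union> Minus ` B"

definition graded_words :: "'b set \<Rightarrow> nat \<Rightarrow> 'b weil_gen list set"
  where "graded_words B j = {w \<in> lists (letters B). sum_list (map gen_degree w) = j}"

lemma graded_words_Nil [simp]: "[] \<in> graded_words B j \<longleftrightarrow> j = 0"
  by (auto simp: graded_words_def)

lemma graded_words_Minus [simp]:
  "Minus b # w \<in> graded_words B j \<longleftrightarrow> b \<in> B \<and> (\<exists>i. j = Suc i \<and> w \<in> graded_words B i)"
  by (auto simp: graded_words_def letters_def)

lemma graded_words_Plus [simp]:
  "Plus b # w \<in> graded_words B j \<longleftrightarrow> b \<in> B \<and> (\<exists>i. j = Suc (Suc i) \<and> w \<in> graded_words B i)"
  by (auto simp: graded_words_def letters_def)

lemma graded_words_0 [simp]: "graded_words B 0 = {[]}"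
proof -
  have "w \<in> graded_words B 0 \<longleftrightarrow> w = []" for w
    by (cases w rule: gen_word_cases) auto
  then show ?thesis by blast
qed

lemma graded_words_append:
  "u \<in> graded_words B i \<Longrightarrow> v \<in> graded_words B j \<Longrightarrow> u @ v \<in> graded_words B (i + j)"
  by (auto simp: graded_words_def)

lemma graded_mult:
  "p \<in> word_span (graded_words B i) \<Longrightarrow> q \<in> word_span (graded_words B j) \<Longrightarrow>
    p * q \<in> word_span (graded_words B (i + j))"
  by (erule word_span_mult) (auto intro: graded_words_append)

lemma word_span_graded_subset:
  "p \<in> word_span (graded_words B j) \<Longrightarrow> p \<in> word_span (lists (letters B))"
  by (rule word_span_mono) (auto simp: graded_words_def)

lemma gen_x_graded: "b \<in> B \<Longrightarrow> gen_x b \<in> word_span (graded_words B (Suc 0))"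
  by (rule fgen_in_word_span) simp

lemma gen_y_graded: "b \<in> B \<Longrightarrow> gen_y b \<in> word_span (graded_words B (Suc (Suc 0)))"
  by (rule fgen_in_word_span) simp

lemma model_d_graded:
  fixes p :: "'b weil_gen list \<Rightarrow>\<^sub>0 'k::field"
  assumes "p \<in> word_span (graded_words B j)"
  shows "model_d p \<in> word_span (graded_words B (Suc j))"
proof -
  have "(model_d_word w :: _ \<Rightarrow>\<^sub>0 'k) \<in> word_span (graded_words B (Suc j))" if "w \<in> graded_words B j" for w
    using that
  proof (induction w arbitrary: j rule: model_d_word.induct)
    case (2 b w)
    then obtain i where i: "j = Suc i" "w \<in> graded_words B i" "b \<in> B"
      by auto
    then have "gen_x b * (model_d_word w :: _ \<Rightarrow>\<^sub>0 'k) \<in> word_span (graded_words B (Suc 0 + Suc i))"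
      by (intro graded_mult gen_x_graded 2)
    with i show ?case
      by (auto intro!: word_span_diff word_span_single)
  next
    case (3 b w)
    then obtain i where i: "j = Suc (Suc i)" "w \<in> graded_words B i" "b \<in> B"
      by auto
    then have "gen_y b * (model_d_word w :: _ \<Rightarrow>\<^sub>0 'k) \<in> word_span (graded_words B (Suc (Suc 0) + Suc i))"
      by (intro graded_mult gen_y_graded 3)
    with i show ?case
      by simp
  qed simp
  with assms show ?thesis
    unfolding model_d_def by (rule lin_ext_word_span)
qed

lemma homotopy_graded:
  assumes "p \<in> word_span (graded_words B (Suc j))"
  shows "homotopy p \<in> word_span (graded_words B j)"
proof -
  have "homotopy_word w \<in> word_span (graded_words B j)" if "w \<in> graded_words B (Suc j)" for w
    using that by (cases w rule: homotopy_word.cases) (auto intro!: word_span_single)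
  with assms show ?thesis
    unfolding homotopy_def by (rule lin_ext_word_span)
qed

lemma lists_letters_graded: "w \<in> lists (letters B) \<Longrightarrow> w \<in> graded_words B (sum_list (map gen_degree w))"
  by (simp add: graded_words_def)

lemma model_d_in_span:
  assumes "p \<in> word_span (lists (letters B))"
  shows "model_d p \<in> word_span (lists (letters B))"
  using assms
proof (induction rule: word_span_induct)
  case (single w c)
  then show ?case
    by (intro word_span_graded_subset
        [OF model_d_graded[OF word_span_single[OF lists_letters_graded]]])
qed (auto simp: model_d_add intro: word_span_add)

lemma model_d_Leibniz:
  assumes "p \<in> word_span (graded_words B i)"
  shows "model_d (p * q) = model_d p * q + fconst ((-1) ^ i) * (p * model_d q)"
  using assms
proof (induction rule: word_span_induct)
  case (single w c)
  then show ?case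
  proof (induction w arbitrary: i)
    case Nil
    have "model_d (fconst c * q) = fconst c * model_d q"
      by (rule model_d_fconst_mult)
    with Nil show ?case
      by (simp flip: fconst_def)
  next
    case (Cons g w)
    show ?case
    proof (cases g)
      case (Minus b)
      with Cons.prems obtain k where k: "i = Suc k" "w \<in> graded_words B k"
        by auto
      from Cons.IH[OF k(2)] k(1) Minus show ?thesis
        by (simp add: model_d_x_mult mult.assoc fconst_uminus algebra_simps
            mult_fconst_left_commute[of "gen_x b"] flip: fgen_mult_single)
    next
      case (Plus b)
      with Cons.prems obtain k where k: "i = Suc (Suc k)" "w \<in> graded_words B k"
        by auto
      from Cons.IH[OF k(2)] k(1) Plus show ?thesis
        by (simp add: model_d_y_mult mult.assoc algebra_simps mult_fconst_left_commute[of "gen_y b"]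
            flip: fgen_mult_single)
    qed
  qed
qed (simp_all add: distrib_left distrib_right model_d_add algebra_simps)


section \<open>Tensor algebras as quotients of free algebras\<close>

text \<open>A set \<open>V\<close> closed under addition and the scalar multiplication \<open>sc\<close>, with only the closure
  properties that are needed to compute in its tensor algebra \<open>T\<close>; \<open>cls\<close> is the projection from the
  free algebra on the set \<open>V\<close>.\<close>

locale tensor_space =
  fixes sc :: "'k::field \<Rightarrow> 'v::ab_group_add \<Rightarrow> 'v" and V :: "'v set"
  assumes zero_in: "0 \<in> V"
    and add_in: "u \<in> V \<Longrightarrow> v \<in> V \<Longrightarrow> u + v \<in> V"
    and scale_in: "v \<in> V \<Longrightarrow> sc c v \<in> V"
begin

abbreviation cls :: "('v list \<Rightarrow>\<^sub>0 'k) \<Rightarrow> ('v list \<Rightarrow>\<^sub>0 'k) set"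
  where "cls \<equiv> tensor_class sc V"

abbreviation T :: "('k, ('v list \<Rightarrow>\<^sub>0 'k) set) module"
  where "T \<equiv> tensor_algebra sc V"

abbreviation free_carrier :: "('v list \<Rightarrow>\<^sub>0 'k) set"
  where "free_carrier \<equiv> word_span (lists V)"

lemma ideal_tensor_ideal: "ideal (tensor_ideal sc V) (free_algebra V)"
  unfolding tensor_ideal_def
  by (rule ring.genideal_ideal[OF ring_free_algebra])
    (auto simp: carrier_free_algebra add_in scale_in
      intro!: word_span_diff word_span_add word_span_fconst_mult fgen_in_word_span)

lemma relation_in_ideal:
  assumes "u \<in> V" "v \<in> V"
  shows "fgen (u + v) - (fgen u + fgen v) \<in> tensor_ideal sc V"
    and "fgen (sc c v) - fconst c * fgen v \<in> tensor_ideal sc V"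
  using assms unfolding tensor_ideal_def genideal_def by blast+

lemma cls_conv: "cls p = (\<lambda>i. i + p) ` tensor_ideal sc V"
  by (auto simp: tensor_class_def a_r_coset_def')

lemma cls_eq_imp_diff:
  assumes "cls p = cls q"
  shows "p - q \<in> tensor_ideal sc V"
proof -
  interpret ideal "tensor_ideal sc V" "free_algebra V"
    by (rule ideal_tensor_ideal)
  have "0 + p \<in> cls p"
    using additive_subgroup.zero_closed[OF is_additive_subgroup]
    unfolding cls_conv by (intro imageI) simp
  with assms obtain i where "i \<in> tensor_ideal sc V" "p = i + q"
    by (auto simp: cls_conv)
  then show ?thesis
    by simp
qed

lemma cls_eqI:
  assumes "p - q \<in> tensor_ideal sc V" "q \<in> free_carrier"
  shows "cls p = cls q"
proof -
  interpret ideal "tensor_ideal sc V" "free_algebra V"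
    by (rule ideal_tensor_ideal)
  have "p = (p - q) + q"
    by simp
  with assms(1) have "p \<in> cls q"
    unfolding cls_conv by blast
  then show ?thesis
    using a_repr_independence[of p "tensor_ideal sc V" q] assms(2) a_subgroup
    by (simp add: tensor_class_def carrier_free_algebra)
qed

lemma tensor_algebra_carrier: "carrier T = cls ` free_carrier"
  by (auto simp: tensor_algebra_def Let_def FactRing_def A_RCOSETS_def' tensor_class_def
      carrier_free_algebra)

lemma cls_in_carrier: "p \<in> free_carrier \<Longrightarrow> cls p \<in> carrier T"
  by (simp add: tensor_algebra_carrier)

lemma cls_ops:
  assumes "p \<in> free_carrier" "q \<in> free_carrier"
  shows "cls p \<oplus>\<^bsub>T\<^esub> cls q = cls (p + q)" "cls p \<otimes>\<^bsub>T\<^esub> cls q = cls (p * q)"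
    and "c \<odot>\<^bsub>T\<^esub> cls p = cls (fconst c * p)"
proof -
  interpret ideal "tensor_ideal sc V" "free_algebra V"
    by (rule ideal_tensor_ideal)
  show "cls p \<oplus>\<^bsub>T\<^esub> cls q = cls (p + q)"
    using a_rcos_sum[of p q] assms
    by (simp add: tensor_algebra_def Let_def FactRing_def tensor_class_def carrier_free_algebra)
  have mult: "cls p \<otimes>\<^bsub>T\<^esub> cls q = cls (p * q)"
    if "p \<in> free_carrier" "q \<in> free_carrier" for p q
    using rcoset_mult_add[of p q] that
    by (simp add: tensor_algebra_def Let_def FactRing_def tensor_class_def carrier_free_algebra)
  from mult assms show "cls p \<otimes>\<^bsub>T\<^esub> cls q = cls (p * q)"
    by blast
  have "c \<odot>\<^bsub>T\<^esub> X = cls (fconst c) \<otimes>\<^bsub>T\<^esub> X" for X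
    by (simp add: tensor_algebra_def Let_def)
  with mult[of "fconst c" p] assms show "c \<odot>\<^bsub>T\<^esub> cls p = cls (fconst c * p)"
    by (simp add: fconst_in_word_span)
qed

lemma cls_0: "\<zero>\<^bsub>T\<^esub> = cls 0"
  by (simp add: cls_conv tensor_algebra_def Let_def FactRing_def)

lemma cls_1: "\<one>\<^bsub>T\<^esub> = cls 1"
  by (simp add: tensor_class_def tensor_algebra_def Let_def FactRing_def)

lemma ring_tensor_algebra: "ring T"
proof (rule ringI)
  show "abelian_group T"
  proof (rule abelian_groupI)
    fix X
    assume "X \<in> carrier T"
    then obtain p where "p \<in> free_carrier" "X = cls p"
      by (auto simp: tensor_algebra_carrier)
    then show "\<exists>Y\<in>carrier T. Y \<oplus>\<^bsub>T\<^esub> X = \<zero>\<^bsub>T\<^esub>"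
      by (intro bexI[of _ "cls (- p)"])
        (simp_all add: cls_ops cls_0 word_span_uminus cls_in_carrier)
  qed (auto simp: tensor_algebra_carrier cls_ops cls_0 word_span_add add_ac)
  show "monoid T"
    by standard
      (auto simp: tensor_algebra_carrier cls_ops cls_1 word_span_lists_mult one_in_word_span
        mult.assoc)
qed (auto simp: tensor_algebra_carrier cls_ops word_span_lists_mult word_span_add
    distrib_left distrib_right)

lemma cls_add_cong:
  assumes "p \<in> free_carrier" "p' \<in> free_carrier" "q \<in> free_carrier" "q' \<in> free_carrier"
    and "cls p = cls p'" "cls q = cls q'"
  shows "cls (p + q) = cls (p' + q')"
  using assms by (simp flip: cls_ops)

lemma cls_mult_cong:
  assumes "p \<in> free_carrier" "p' \<in> free_carrier" "q \<in> free_carrier" "q' \<in> free_carrier"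
    and "cls p = cls p'" "cls q = cls q'"
  shows "cls (p * q) = cls (p' * q')"
  using assms by (simp flip: cls_ops)

lemma cls_fgen_add:
  "u \<in> V \<Longrightarrow> v \<in> V \<Longrightarrow> cls (fgen (u + v)) = cls (fgen u + fgen v)"
  by (auto intro!: cls_eqI relation_in_ideal word_span_add fgen_in_word_span)

lemma cls_fgen_scale: "v \<in> V \<Longrightarrow> cls (fgen (sc c v)) = cls (fconst c * fgen v)"
  by (auto intro!: cls_eqI relation_in_ideal word_span_fconst_mult fgen_in_word_span)

lemma cls_fgen_0: "cls (fgen 0) = cls 0"
proof (rule cls_eqI)
  interpret ideal "tensor_ideal sc V" "free_algebra V"
    by (rule ideal_tensor_ideal)
  \<comment> \<open>The additivity relation for \<open>0 + 0 = 0\<close>.\<close>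
  have "- fgen 0 \<in> tensor_ideal sc V"
    using relation_in_ideal(1)[OF zero_in zero_in] by simp
  then have "(- fconst 1) * (- fgen 0) \<in> tensor_ideal sc V"
    using I_l_closed[of "- fgen 0" "- fconst 1"]
    by (auto simp: carrier_free_algebra word_span_uminus one_in_word_span)
  then show "fgen 0 - 0 \<in> tensor_ideal sc V"
    by simp
qed simp

lemma sum_in: "(\<And>i. i \<in> I \<Longrightarrow> f i \<in> V) \<Longrightarrow> sum f I \<in> V"
  by (induction I rule: infinite_finite_induct) (simp_all add: zero_in add_in)

lemma cls_fgen_sum:
  assumes "\<And>i. i \<in> I \<Longrightarrow> v i \<in> V"
  shows "cls (fgen (\<Sum>i\<in>I. sc (c i) (v i))) = cls (\<Sum>i\<in>I. fconst (c i) * fgen (v i))"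
  using assms
proof (induction I rule: infinite_finite_induct)
  case (insert i I)
  let ?s = "\<Sum>i\<in>I. sc (c i) (v i)" and ?p = "\<Sum>i\<in>I. fconst (c i) * fgen (v i)"
  have "?p \<in> free_carrier"
    using insert.prems by (auto intro!: word_span_sum word_span_fconst_mult fgen_in_word_span)
  moreover have "?s \<in> V"
    using insert.prems by (auto intro!: sum_in scale_in)
  ultimately have "cls (fgen (sc (c i) (v i)) + fgen ?s) = cls (fconst (c i) * fgen (v i) + ?p)"
    using insert
    by (intro cls_add_cong)
      (simp_all add: cls_fgen_scale scale_in fgen_in_word_span word_span_fconst_mult)
  then have "cls (fgen (sc (c i) (v i) + ?s)) = cls (fconst (c i) * fgen (v i) + ?p)"
    using insert \<open>?s \<in> V\<close> by (simp add: cls_fgen_add scale_in)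
  with insert show ?case
    by simp
qed (simp_all add: cls_fgen_0)

text \<open>The universal property: the homomorphism that extends a linear map on \<open>V\<close> factors through the
  tensor algebra.\<close>

lemma alg_ext_tensor_ideal:
  assumes add: "\<And>u v. u \<in> V \<Longrightarrow> v \<in> V \<Longrightarrow> f (u + v) = f u + f v"
    and scale: "\<And>c v. v \<in> V \<Longrightarrow> f (sc c v) = fconst c * f v"
    and p: "p \<in> tensor_ideal sc V"
  shows "alg_ext f p = 0"
proof -
  interpret R: ring "free_algebra V :: ('v list \<Rightarrow>\<^sub>0 'k) ring"
    by (rule ring_free_algebra)
  let ?K = "{p \<in> free_carrier. alg_ext f p = 0}"
  have inv: "\<ominus>\<^bsub>free_algebra V\<^esub> q = - q" if "q \<in> free_carrier" for q :: "'v list \<Rightarrow>\<^sub>0 'k"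
    using R.minus_equality[of "- q" q] that
    by (simp add: carrier_free_algebra word_span_uminus)
  have "subgroup ?K (add_monoid (free_algebra V))"
    by (rule R.add.subgroupI)
      (auto simp: carrier_free_algebra word_span_add alg_ext_add inv word_span_uminus alg_ext_uminus
        intro: exI[of _ 0])
  then have "ideal ?K (free_algebra V)"
    by (rule idealI[OF ring_free_algebra])
      (auto simp: carrier_free_algebra word_span_lists_mult alg_ext_mult)
  then have "tensor_ideal sc V \<subseteq> ?K"
    unfolding tensor_ideal_def
  proof (rule R.genideal_minimal)
    show "{fgen (u + v) - (fgen u + fgen v) | u v. u \<in> V \<and> v \<in> V} \<union>
        {fgen (sc c v) - fconst c * fgen v | c v. v \<in> V} \<subseteq> ?K"
      by (auto simp: alg_ext_diff alg_ext_add alg_ext_fconst_mult add scale add_in scale_in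
          intro!: word_span_diff word_span_add word_span_fconst_mult fgen_in_word_span)
  qed
  with p show ?thesis
    by blast
qed

end


section \<open>A basis and its dual\<close>

lemma sum_fun_apply: "(\<Sum>i\<in>I. f i) a = (\<Sum>i\<in>I. f i a)"
  by (induction I rule: infinite_finite_induct) simp_all

text \<open>A finite-dimensional algebra with a chosen basis \<open>B\<close>. The elements of \<open>B\<close> also index the letters
  \<open>x\<^sub>b\<close> and \<open>y\<^sub>b\<close>.\<close>

locale based_algebra = fin_dim_algebra scale
  for scale :: "'k::field \<Rightarrow> 'a::ring \<Rightarrow> 'a" +
  fixes B :: "'a set"
  assumes finite_B: "finite B" and independent_B: "independent B" and span_B: "span B = UNIV"
begin

lemma dual_iff:
  "l \<in> dual scale \<longleftrightarrow> (\<forall>a b. l (a + b) = l a + l b) \<and> (\<forall>c a. l (scale c a) = c * l a)"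
proof -
  have "vector_space ((*) :: 'k \<Rightarrow> 'k \<Rightarrow> 'k)"
    by standard (simp_all add: algebra_simps)
  then have "module_hom scale (*) l \<longleftrightarrow>
      (\<forall>a b. l (a + b) = l a + l b) \<and> (\<forall>c a. l (scale c a) = c * l a)"
    unfolding module_hom_def module_hom_axioms_def
    using module_axioms by (auto simp: module_iff_vector_space)
  then show ?thesis
    by (simp add: dual_def module_hom_iff_linear)
qed

lemma dual_add: "l \<in> dual scale \<Longrightarrow> l (a + b) = l a + l b"
  and dual_scale: "l \<in> dual scale \<Longrightarrow> l (scale c a) = c * l a"
  by (simp_all add: dual_iff)

lemma dual_0: "l \<in> dual scale \<Longrightarrow> l 0 = 0"
  using dual_scale[of l 0 0] by simp

lemma dual_sum: "l \<in> dual scale \<Longrightarrow> l (sum f I) = (\<Sum>i\<in>I. l (f i))"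
  by (induction I rule: infinite_finite_induct) (simp_all add: dual_0 dual_add)

text \<open>The dual basis.\<close>

definition coord :: "'a \<Rightarrow> 'a \<Rightarrow> 'k"
  where "coord b = (\<lambda>a. representation B a b)"

lemma coord_in_dual: "coord b \<in> dual scale"
  using linear_representation[OF independent_B span_B] by (simp add: dual_def coord_def)

lemma coord_basis: "b \<in> B \<Longrightarrow> c \<in> B \<Longrightarrow> coord b c = (if b = c then 1 else 0)"
  by (auto simp: coord_def representation_basis[OF independent_B])

lemma sum_coord: "(\<Sum>b\<in>B. scale (coord b a) b) = a"
  unfolding coord_def
  using sum_representation_eq[OF independent_B _ finite_B order_refl, of a] by (simp add: span_B)

lemma dual_expand: "l \<in> dual scale \<Longrightarrow> (\<Sum>b\<in>B. l b * coord b a) = l a"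
  using dual_sum[of l "\<lambda>b. scale (coord b a) b" B]
  by (simp add: sum_coord dual_scale mult.commute)

lemma dual_mult_left: "l \<in> dual scale \<Longrightarrow> (\<lambda>a. l (b * a)) \<in> dual scale"
  by (auto simp: dual_iff distrib_left scale_mult_right)

text \<open>With the dual basis \<open>b\<^sup>*\<close>, \<open>\<Delta> l = \<Sum>\<^sub>b b\<^sup>* \<otimes> l (b _)\<close>.\<close>

lemma comult_repr_exists:
  assumes "l \<in> dual scale"
  obtains n f g where "comult_repr scale l n f g"
proof -
  obtain h where h: "bij_betw h {0..<card B} B"
    using ex_bij_betw_nat_finite[OF finite_B] by blast
  have "l (a * b) = (\<Sum>i<card B. coord (h i) a * l (h i * b))" for a b
  proof -
    have "l (a * b) = l ((\<Sum>c\<in>B. scale (coord c a) c) * b)"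
      by (simp add: sum_coord)
    also have "\<dots> = (\<Sum>c\<in>B. coord c a * l (c * b))"
      using assms by (simp add: sum_distrib_right scale_mult_left dual_sum dual_scale)
    also have "\<dots> = (\<Sum>i<card B. coord (h i) a * l (h i * b))"
      using sum.reindex_bij_betw[OF h, of "\<lambda>c. coord c a * l (c * b)"]
      by (simp add: atLeast0LessThan)
    finally show ?thesis .
  qed
  with assms have "comult_repr scale l (card B) (\<lambda>i. coord (h i)) (\<lambda>i a. l (h i * a))"
    unfolding comult_repr_def by (blast intro: coord_in_dual dual_mult_left)
  then show thesis ..
qed

sublocale weil: tensor_space dual2_scale "dual2 scale"
  by standard (auto simp: dual2_def dual2_scale_def dual_iff zero_prod_def algebra_simps)


section \<open>The Weil algebra as a free algebra on contractible generators\<close>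

abbreviation model :: "('a weil_gen list \<Rightarrow>\<^sub>0 'k) set"
  where "model \<equiv> word_span (lists (letters B))"

abbreviation graded_model :: "nat \<Rightarrow> ('a weil_gen list \<Rightarrow>\<^sub>0 'k) set"
  where "graded_model j \<equiv> word_span (graded_words B j)"

text \<open>The elements of the model that correspond to \<open>l\<^sub>-\<close> and to \<open>d l\<^sub>-\<close>.\<close>

definition lin_x :: "('a \<Rightarrow> 'k) \<Rightarrow> ('a weil_gen list \<Rightarrow>\<^sub>0 'k)"
  where "lin_x l = (\<Sum>b\<in>B. fconst (l b) * gen_x b)"

definition lin_y :: "('a \<Rightarrow> 'k) \<Rightarrow> ('a weil_gen list \<Rightarrow>\<^sub>0 'k)"
  where "lin_y l = (\<Sum>b\<in>B. fconst (l b) * gen_y b)"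

text \<open>The element \<open>\<Sum> l'\<^sub>- l''\<^sub>-\<close>, written without a Sweedler representation: the coefficient of
  \<open>x\<^sub>b x\<^sub>c\<close> is \<open>l (b c)\<close>.\<close>

definition quad_x :: "('a \<Rightarrow> 'k) \<Rightarrow> ('a weil_gen list \<Rightarrow>\<^sub>0 'k)"
  where "quad_x l = (\<Sum>b\<in>B. \<Sum>c\<in>B. fconst (l (b * c)) * (gen_x b * gen_x c))"

text \<open>The change of generators: \<open>l\<^sub>+ = d l\<^sub>- - \<Sum> l'\<^sub>- l''\<^sub>-\<close>, and conversely \<open>y\<^sub>b\<close> goes to
  \<open>b\<^sup>*\<^sub>+ + \<Sum> (b\<^sup>*)'\<^sub>- (b\<^sup>*)''\<^sub>-\<close> with the dual basis \<open>b\<^sup>*\<close>. The two extensions are homomorphisms between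
  free algebras. The composition \<open>to_model \<circ> from_model\<close> is the identity of the model, but
  \<open>from_model \<circ> to_model\<close> is the identity only modulo the tensor ideal, as a letter \<open>(l, m)\<close> is
  replaced by its expansion in the dual basis.\<close>

definition to_model_gen :: "('k, 'a) dual2 \<Rightarrow> ('a weil_gen list \<Rightarrow>\<^sub>0 'k)"
  where "to_model_gen v = lin_y (fst v) - quad_x (fst v) + lin_x (snd v)"

definition to_model :: "(('k, 'a) dual2 list \<Rightarrow>\<^sub>0 'k) \<Rightarrow> ('a weil_gen list \<Rightarrow>\<^sub>0 'k)"
  where "to_model = alg_ext to_model_gen"

primrec from_model_gen :: "'a weil_gen \<Rightarrow> (('k, 'a) dual2 list \<Rightarrow>\<^sub>0 'k)"
  where "from_model_gen (Minus b) = fgen (0, coord b)"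
  | "from_model_gen (Plus b) = fgen (coord b, 0) +
      (\<Sum>c\<in>B. \<Sum>c'\<in>B. fconst (coord b (c * c')) * (fgen (0, coord c) * fgen (0, coord c')))"

definition from_model :: "('a weil_gen list \<Rightarrow>\<^sub>0 'k) \<Rightarrow> (('k, 'a) dual2 list \<Rightarrow>\<^sub>0 'k)"
  where "from_model = alg_ext from_model_gen"

lemma lin_x_graded: "lin_x l \<in> graded_model 1"
  by (auto simp: lin_x_def intro!: word_span_sum word_span_fconst_mult gen_x_graded)

lemma lin_y_graded: "lin_y l \<in> graded_model 2"
  by (auto simp: lin_y_def numeral_2_eq_2 intro!: word_span_sum word_span_fconst_mult gen_y_graded)

lemma quad_x_graded: "quad_x l \<in> graded_model 2"
proof -
  have "gen_x b * gen_x c \<in> graded_model (Suc 0 + Suc 0)" if "b \<in> B" "c \<in> B" for b c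
    using that by (intro graded_mult gen_x_graded)
  then show ?thesis
    by (auto simp: quad_x_def numeral_2_eq_2 intro!: word_span_sum word_span_fconst_mult)
qed

lemmas lin_in_model [simp] =
  word_span_graded_subset[OF lin_x_graded] word_span_graded_subset[OF lin_y_graded]
  word_span_graded_subset[OF quad_x_graded]

lemma lin_0 [simp]: "lin_x 0 = 0" "lin_y 0 = 0" "quad_x 0 = 0"
  by (simp_all add: lin_x_def lin_y_def quad_x_def)

lemma lin_add:
  "lin_x (l + m) = lin_x l + lin_x m" "lin_y (l + m) = lin_y l + lin_y m"
  "quad_x (l + m) = quad_x l + quad_x m"
  by (simp_all add: lin_x_def lin_y_def quad_x_def fconst_add distrib_right sum.distrib)

lemma lin_scale:
  "lin_x (\<lambda>a. c * l a) = fconst c * lin_x l" "lin_y (\<lambda>a. c * l a) = fconst c * lin_y l"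
  "quad_x (\<lambda>a. c * l a) = fconst c * quad_x l"
  by (simp_all add: lin_x_def lin_y_def quad_x_def fconst_mult sum_distrib_left mult.assoc)

lemma dual_zero [simp]: "0 \<in> dual scale"
  by (simp add: dual_iff)

lemma fgen_dual2_in: "l \<in> dual scale \<Longrightarrow> m \<in> dual scale \<Longrightarrow> fgen (l, m) \<in> weil.free_carrier"
  by (rule fgen_in_word_span) (simp add: dual2_def)

lemma to_model_in: "p \<in> weil.free_carrier \<Longrightarrow> to_model p \<in> model"
  unfolding to_model_def
  by (erule alg_ext_in_word_span) (auto simp: to_model_gen_def intro!: word_span_add word_span_diff)

lemma from_model_in: "p \<in> model \<Longrightarrow> from_model p \<in> weil.free_carrier"
  unfolding from_model_def
  by (erule alg_ext_in_word_span)
    (auto simp: letters_def coord_in_dual intro!: word_span_add word_span_sum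
      word_span_fconst_mult word_span_lists_mult fgen_dual2_in)

lemma to_model_tensor_ideal:
  assumes "p \<in> tensor_ideal dual2_scale (dual2 scale)"
  shows "to_model p = 0"
  unfolding to_model_def
  by (rule weil.alg_ext_tensor_ideal[OF _ _ assms])
    (simp_all add: to_model_gen_def dual2_scale_def lin_add lin_scale right_diff_distrib distrib_left)

lemma sum_delta_fconst:
  assumes "b \<in> B"
  shows "(\<Sum>c\<in>B. fconst (coord b c) * f c) = f b"
proof -
  have "(\<Sum>c\<in>B. fconst (coord b c) * f c) = (\<Sum>c\<in>B. if c = b then f c else 0)"
    using assms by (intro sum.cong) (auto simp: coord_basis)
  with assms finite_B show ?thesis
    by simp
qed

lemma to_model_from_model:
  assumes "p \<in> model"
  shows "to_model (from_model p) = p"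
proof -
  have gen: "to_model (from_model_gen g) = fgen g" if "g \<in> letters B" for g
    using that
    by (auto simp: letters_def to_model_def to_model_gen_def alg_ext_add alg_ext_sum alg_ext_mult
        alg_ext_fconst_mult lin_x_def lin_y_def quad_x_def sum_delta_fconst)
  show ?thesis
    using assms
  proof (induction rule: word_span_induct)
    case (single w c)
    then show ?case
    proof (induction w)
      case Nil
      then show ?case
        by (simp add: to_model_def from_model_def flip: fconst_def)
    next
      case (Cons g w)
      then show ?case
        using gen[of g]
        by (simp add: to_model_def from_model_def alg_ext_mult flip: fgen_mult_single)
    qed
  qed (simp_all add: to_model_def from_model_def alg_ext_add)
qed

text \<open>Linear combinations of quadratic elements, computed on the coefficients.\<close>

lemma sum_sum_fconst_mult:
  "(\<Sum>i\<in>I. fconst (u i) * (\<Sum>b\<in>B. \<Sum>c\<in>B. fconst (t i b c) * X b c)) =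
    (\<Sum>b\<in>B. \<Sum>c\<in>B. fconst (\<Sum>i\<in>I. u i * t i b c) * X b c)"
proof -
  have "(\<Sum>i\<in>I. fconst (u i) * (\<Sum>b\<in>B. \<Sum>c\<in>B. fconst (t i b c) * X b c)) =
      (\<Sum>i\<in>I. \<Sum>b\<in>B. \<Sum>c\<in>B. fconst (u i * t i b c) * X b c)"
    by (simp add: sum_distrib_left fconst_mult mult.assoc)
  also have "\<dots> = (\<Sum>b\<in>B. \<Sum>i\<in>I. \<Sum>c\<in>B. fconst (u i * t i b c) * X b c)"
    by (rule sum.swap)
  also have "\<dots> = (\<Sum>b\<in>B. \<Sum>c\<in>B. \<Sum>i\<in>I. fconst (u i * t i b c) * X b c)"
    by (intro sum.cong refl sum.swap)
  finally show ?thesis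
    by (simp add: fconst_sum sum_distrib_right)
qed

lemma from_model_quad_x:
  "from_model (quad_x l) =
    (\<Sum>b\<in>B. \<Sum>c\<in>B. fconst (l (b * c)) * (fgen (0, coord b) * fgen (0, coord c)))"
  by (simp add: quad_x_def from_model_def alg_ext_sum alg_ext_fconst_mult alg_ext_mult)

lemma from_model_lin_y:
  assumes "l \<in> dual scale"
  shows "from_model (lin_y l) = (\<Sum>b\<in>B. fconst (l b) * fgen (coord b, 0)) + from_model (quad_x l)"
proof -
  have "from_model (lin_y l) = (\<Sum>b\<in>B. fconst (l b) * fgen (coord b, 0)) +
      (\<Sum>b\<in>B. \<Sum>c\<in>B. fconst (\<Sum>d\<in>B. l d * coord d (b * c)) *
        (fgen (0, coord b) * fgen (0, coord c)))"
    by (simp add: lin_y_def from_model_def alg_ext_sum alg_ext_fconst_mult distrib_left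
        sum.distrib sum_sum_fconst_mult)
  with assms show ?thesis
    by (simp add: dual_expand from_model_quad_x)
qed

lemma from_model_to_model_gen:
  assumes "l \<in> dual scale" "m \<in> dual scale"
  shows "weil.cls (from_model (to_model_gen (l, m))) = weil.cls (fgen (l, m))"
proof -
  let ?p = "\<Sum>b\<in>B. fconst (l b) * fgen (coord b, 0)"
  let ?q = "\<Sum>b\<in>B. fconst (m b) * fgen (0, coord b)"
  have "(\<Sum>b\<in>B. dual2_scale (l b) (coord b, 0)) = (l, 0)"
    using assms
    by (intro prod_eqI ext)
      (simp_all add: fst_sum snd_sum dual2_scale_def sum_fun_apply dual_expand)
  then have p: "weil.cls (fgen (l, 0)) = weil.cls ?p"
    using weil.cls_fgen_sum[of B "\<lambda>b. (coord b, 0)" l] by (simp add: dual2_def coord_in_dual)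
  have "(\<Sum>b\<in>B. dual2_scale (m b) (0, coord b)) = (0, m)"
    using assms
    by (intro prod_eqI ext)
      (simp_all add: fst_sum snd_sum dual2_scale_def sum_fun_apply dual_expand)
  then have q: "weil.cls (fgen (0, m)) = weil.cls ?q"
    using weil.cls_fgen_sum[of B "\<lambda>b. (0, coord b)" m] by (simp add: dual2_def coord_in_dual)
  have "from_model (to_model_gen (l, m)) =
      from_model (lin_y l) - from_model (quad_x l) + from_model (lin_x m)"
    by (simp add: to_model_gen_def from_model_def alg_ext_add alg_ext_diff)
  also have "\<dots> = ?p + ?q"
    using assms(1)
    by (simp add: from_model_lin_y)
      (simp add: from_model_def lin_x_def alg_ext_sum alg_ext_fconst_mult)
  finally have "weil.cls (from_model (to_model_gen (l, m))) = weil.cls (?p + ?q)"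
    by simp
  also have "\<dots> = weil.cls (fgen (l, 0) + fgen (0, m))"
    using assms p q
    by (intro weil.cls_add_cong)
      (auto intro!: word_span_sum word_span_fconst_mult fgen_dual2_in coord_in_dual)
  also have "\<dots> = weil.cls (fgen (l, m))"
    using weil.cls_fgen_add[of "(l, 0)" "(0, m)"] assms by (simp add: dual2_def)
  finally show ?thesis .
qed

lemma from_model_to_model:
  assumes "p \<in> weil.free_carrier"
  shows "weil.cls (from_model (to_model p)) = weil.cls p"
  using assms
proof (induction rule: word_span_induct)
  case zero
  then show ?case
    by (simp add: from_model_def to_model_def)
next
  case (single w c)
  then show ?case
  proof (induction w)
    case Nil
    show ?case
      by (simp add: from_model_def to_model_def flip: fconst_def)
  next
    case (Cons v w)
    have v: "fgen v \<in> weil.free_carrier" and w: "Poly_Mapping.single w c \<in> weil.free_carrier"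
      using Cons.hyps by (simp_all add: fgen_in_word_span word_span_single)
    have "weil.cls (from_model (to_model (fgen v))) = weil.cls (fgen v)"
      using Cons.hyps from_model_to_model_gen[of "fst v" "snd v"]
      by (auto simp: dual2_def to_model_def)
    with Cons.IH v w have "weil.cls (from_model (to_model (fgen v)) *
        from_model (to_model (Poly_Mapping.single w c))) =
        weil.cls (fgen v * Poly_Mapping.single w c)"
      by (intro weil.cls_mult_cong) (auto intro!: from_model_in to_model_in)
    then show ?case
      by (simp add: from_model_def to_model_def alg_ext_mult flip: fgen_mult_single)
  qed
next
  case (add p q)
  then have "weil.cls (from_model (to_model p) + from_model (to_model q)) = weil.cls (p + q)"
    by (intro weil.cls_add_cong) (auto intro!: from_model_in to_model_in)
  then show ?case
    by (simp add: from_model_def to_model_def alg_ext_add)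
qed

abbreviation W :: "('k, ('k, 'a) weil) module"
  where "W \<equiv> weil_algebra scale"

text \<open>The isomorphism of algebras from the model onto the Weil algebra.\<close>

definition weil_of :: "('a weil_gen list \<Rightarrow>\<^sub>0 'k) \<Rightarrow> ('k, 'a) weil"
  where "weil_of p = weil.cls (from_model p)"

lemma carrier_weil: "carrier W = weil_of ` model"
proof
  show "carrier W \<subseteq> weil_of ` model"
  proof
    fix X assume "X \<in> carrier W"
    then obtain p where "p \<in> weil.free_carrier" "X = weil.cls p"
      by (auto simp: weil_algebra_def weil.tensor_algebra_carrier)
    then show "X \<in> weil_of ` model"
      by (intro image_eqI[of _ _ "to_model p"]) (simp_all add: weil_of_def from_model_to_model to_model_in)
  qed
  show "weil_of ` model \<subseteq> carrier W"
    by (auto simp: weil_algebra_def weil_of_def intro: weil.cls_in_carrier from_model_in)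
qed

lemma weil_of_in [simp]: "p \<in> model \<Longrightarrow> weil_of p \<in> carrier W"
  by (simp add: carrier_weil)

lemma inj_on_weil_of: "inj_on weil_of model"
proof (rule inj_onI)
  fix p q
  assume pq: "p \<in> model" "q \<in> model" "weil_of p = weil_of q"
  then have "from_model p - from_model q \<in> tensor_ideal dual2_scale (dual2 scale)"
    by (intro weil.cls_eq_imp_diff) (simp add: weil_of_def)
  then have "to_model (from_model p - from_model q) = 0"
    by (rule to_model_tensor_ideal)
  then have "to_model (from_model p) = to_model (from_model q)"
    by (simp add: to_model_def alg_ext_diff)
  with pq show "p = q"
    by (simp add: to_model_from_model)
qed

lemma weil_of_eq_iff: "p \<in> model \<Longrightarrow> q \<in> model \<Longrightarrow> weil_of p = weil_of q \<longleftrightarrow> p = q"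
  using inj_on_weil_of by (auto simp: inj_on_def)

lemma weil_of_add: "p \<in> model \<Longrightarrow> q \<in> model \<Longrightarrow> weil_of (p + q) = weil_of p \<oplus>\<^bsub>W\<^esub> weil_of q"
  using from_model_in[of p] from_model_in[of q]
  by (simp add: weil_of_def weil_algebra_def weil.cls_ops) (simp add: from_model_def alg_ext_add)

lemma weil_of_mult: "p \<in> model \<Longrightarrow> q \<in> model \<Longrightarrow> weil_of (p * q) = weil_of p \<otimes>\<^bsub>W\<^esub> weil_of q"
  using from_model_in[of p] from_model_in[of q]
  by (simp add: weil_of_def weil_algebra_def weil.cls_ops) (simp add: from_model_def alg_ext_mult)

lemma weil_of_smult: "p \<in> model \<Longrightarrow> weil_of (fconst c * p) = c \<odot>\<^bsub>W\<^esub> weil_of p"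
  using from_model_in[of p]
  by (simp add: weil_of_def weil_algebra_def weil.cls_ops)
    (simp add: from_model_def alg_ext_fconst_mult)

lemma weil_of_0: "weil_of 0 = \<zero>\<^bsub>W\<^esub>"
  by (simp add: weil_of_def weil_algebra_def weil.cls_0 from_model_def)

sublocale W: ring W
  unfolding weil_algebra_def by (rule weil.ring_tensor_algebra)

lemma weil_of_uminus:
  assumes "p \<in> model"
  shows "weil_of (- p) = \<ominus>\<^bsub>W\<^esub> weil_of p"
  using assms weil_of_add[of "- p" p]
  by (intro W.minus_equality[symmetric]) (simp_all add: word_span_uminus weil_of_0)

lemma weil_of_diff: "p \<in> model \<Longrightarrow> q \<in> model \<Longrightarrow> weil_of (p - q) = weil_of p \<ominus>\<^bsub>W\<^esub> weil_of q"
  using weil_of_add[of p "- q"] by (simp add: weil_of_uminus word_span_uminus a_minus_def)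

lemma weil_of_sum:
  assumes "\<And>i. i \<in> I \<Longrightarrow> f i \<in> model"
  shows "weil_of (sum f I) = (\<Oplus>\<^bsub>W\<^esub>i\<in>I. weil_of (f i))"
  using assms
proof (induction I rule: infinite_finite_induct)
  case (insert i I)
  then show ?case
    by (simp add: weil_of_add word_span_sum W.finsum_insert Pi_iff)
qed (simp_all add: weil_of_0)

lemma weil_minus_eq:
  assumes "l \<in> dual scale"
  shows "weil_minus scale l = weil_of (lin_x l)"
  using from_model_to_model_gen[of 0 l] assms
  by (simp add: weil_minus_def weil_of_def to_model_gen_def)

lemma weil_plus_eq:
  assumes "l \<in> dual scale"
  shows "weil_plus scale l = weil_of (lin_y l - quad_x l)"
  using from_model_to_model_gen[of l 0] assms
  by (simp add: weil_plus_def weil_of_def to_model_gen_def)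

lemma weil_words_Nil: "[] \<in> weil_words scale 0"
  unfolding weil_words_def by (auto intro!: exI[of _ "[]"])

lemma weil_words_gen:
  "gen_functional g \<in> dual scale \<Longrightarrow> [gen_vector g] \<in> weil_words scale (gen_degree g)"
  unfolding weil_words_def by (auto intro!: exI[of _ "[g]"])

lemma weil_words_append:
  assumes "u \<in> weil_words scale i" "v \<in> weil_words scale j"
  shows "u @ v \<in> weil_words scale (i + j)"
proof -
  obtain gs hs where "u = map gen_vector gs" "v = map gen_vector hs"
    "gen_functional ` set gs \<subseteq> dual scale" "gen_functional ` set hs \<subseteq> dual scale"
    "sum_list (map gen_degree gs) = i" "sum_list (map gen_degree hs) = j"
    using assms by (auto simp: weil_words_def)
  then show ?thesis
    unfolding weil_words_def by (auto simp: image_subset_iff intro!: exI[of _ "gs @ hs"])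
qed

lemma weil_words_lists: "weil_words scale j \<subseteq> lists (dual2 scale)"
proof -
  have "gen_vector g \<in> dual2 scale" if "gen_functional g \<in> dual scale" for g :: "('a \<Rightarrow> 'k) weil_gen"
    using that by (cases g) (auto simp: dual2_def)
  then show ?thesis
    by (auto simp: weil_words_def image_subset_iff)
qed

lemma weil_degree_eq: "weil_degree scale j = weil_of ` graded_model j"
proof -
  have to: "to_model p \<in> graded_model j" if "p \<in> word_span (weil_words scale j)" for p
    unfolding to_model_def alg_ext_def using that
  proof (rule lin_ext_word_span)
    fix w assume "w \<in> weil_words scale j"
    then obtain gs where gs: "w = map gen_vector gs" "sum_list (map gen_degree gs) = j"
      by (auto simp: weil_words_def)
    have "to_model_gen (gen_vector g) \<in> graded_model (gen_degree g)" for g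
      using lin_x_graded lin_y_graded quad_x_graded
      by (cases g) (auto simp: to_model_gen_def intro: word_span_diff)
    then have "prod_list (map (\<lambda>g. to_model_gen (gen_vector g)) gs) \<in>
        graded_model (sum_list (map gen_degree gs))"
      by (intro prod_list_in_word_span) (auto intro: graded_words_append)
    with gs show "prod_list (map to_model_gen w) \<in> graded_model j"
      by (simp add: comp_def)
  qed
  have "from_model p \<in> word_span (weil_words scale j)" if "p \<in> graded_model j" for p
    unfolding from_model_def alg_ext_def using that
  proof (rule lin_ext_word_span)
    fix w assume w: "w \<in> graded_words B j"
    have minus: "fgen (0, coord b) \<in> word_span (weil_words scale (Suc 0))" for b
      using weil_words_gen[of "Minus (coord b)"]
      by (intro fgen_in_word_span) (simp add: coord_in_dual)
    have plus: "fgen (coord b, 0) \<in> word_span (weil_words scale 2)" for b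
      using weil_words_gen[of "Plus (coord b)"]
      by (intro fgen_in_word_span) (simp add: coord_in_dual)
    have "fgen (0, coord b) * fgen (0, coord c) \<in> word_span (weil_words scale (Suc 0 + Suc 0))" for b c
      by (rule word_span_mult[OF minus minus]) (rule weil_words_append)
    then have "from_model_gen g \<in> word_span (weil_words scale (gen_degree g))" for g
      using minus plus
      by (cases g)
        (auto simp: numeral_2_eq_2 intro!: word_span_add word_span_sum word_span_fconst_mult)
    then have "prod_list (map from_model_gen w) \<in>
        word_span (weil_words scale (sum_list (map gen_degree w)))"
      by (intro prod_list_in_word_span) (auto intro: weil_words_append weil_words_Nil)
    with w show "prod_list (map from_model_gen w) \<in> word_span (weil_words scale j)"
      by (simp add: graded_words_def)
  qed
  moreover have "weil.cls p = weil_of (to_model p)" if "p \<in> word_span (weil_words scale j)" for p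
    using that by (simp add: weil_of_def from_model_to_model word_span_mono[OF weil_words_lists])
  ultimately show ?thesis
    using to by (auto simp: weil_degree_def weil_of_def simp flip: word_span_def)
qed

end


section \<open>The Weil differential in the model\<close>

context based_algebra
begin

text \<open>The cubic element of the model with coefficients \<open>t\<close>.\<close>

definition cubic_x :: "('a \<Rightarrow> 'a \<Rightarrow> 'a \<Rightarrow> 'k) \<Rightarrow> ('a weil_gen list \<Rightarrow>\<^sub>0 'k)"
  where "cubic_x t = (\<Sum>a\<in>B. \<Sum>b\<in>B. \<Sum>c\<in>B. fconst (t a b c) * (gen_x a * (gen_x b * gen_x c)))"

lemma lin_x_mult_lin_x:
  "lin_x l * lin_x m = (\<Sum>b\<in>B. \<Sum>c\<in>B. fconst (l b * m c) * (gen_x b * gen_x c))"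
  by (simp add: lin_x_def sum_product fconst_mult mult.assoc mult_fconst_left_commute[of "gen_x _"])

lemma lin_x_mult_quad_x: "lin_x l * quad_x m = cubic_x (\<lambda>a b c. l a * m (b * c))"
proof -
  have "lin_x l * quad_x m = (\<Sum>a\<in>B. fconst (l a) * (gen_x a * quad_x m))"
    by (simp add: lin_x_def sum_distrib_right mult.assoc)
  also have "\<dots> = cubic_x (\<lambda>a b c. l a * m (b * c))"
    by (simp add: cubic_x_def quad_x_def sum_distrib_left fconst_mult mult.assoc
        mult_fconst_left_commute[of "gen_x _"])
  finally show ?thesis .
qed

lemma quad_x_mult_lin_x: "quad_x l * lin_x m = cubic_x (\<lambda>a b c. l (a * b) * m c)"
proof -
  have "quad_x l * lin_x m =
      (\<Sum>a\<in>B. \<Sum>b\<in>B. fconst (l (a * b)) * (gen_x a * (gen_x b * lin_x m)))"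
    by (simp add: quad_x_def sum_distrib_right mult.assoc)
  also have "\<dots> = cubic_x (\<lambda>a b c. l (a * b) * m c)"
    by (simp add: cubic_x_def lin_x_def sum_distrib_left fconst_mult mult.assoc
        mult_fconst_left_commute[of "gen_x _"])
  finally show ?thesis .
qed

lemma sum_cubic_x: "(\<Sum>i\<in>I. cubic_x (t i)) = cubic_x (\<lambda>a b c. \<Sum>i\<in>I. t i a b c)"
  by (induction I rule: infinite_finite_induct)
    (simp_all add: cubic_x_def fconst_add distrib_right sum.distrib)

lemma comult_repr_quad_x:
  assumes "comult_repr scale l n f g"
  shows "quad_x l = (\<Sum>i<n. lin_x (f i) * lin_x (g i))"
proof -
  have "quad_x l = (\<Sum>b\<in>B. \<Sum>c\<in>B. fconst (\<Sum>i<n. f i b * g i c) * (gen_x b * gen_x c))"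
    using assms by (simp add: quad_x_def comult_repr_def)
  also have "\<dots> = (\<Sum>i<n. fconst 1 * (\<Sum>b\<in>B. \<Sum>c\<in>B. fconst (f i b * g i c) * (gen_x b * gen_x c)))"
    by (subst sum_sum_fconst_mult) simp
  finally show ?thesis
    by (simp add: lin_x_mult_lin_x)
qed

text \<open>Coassociativity of the comultiplication, from the associativity of the product: both sides have
  the coefficient \<open>l (a b c)\<close> at \<open>x\<^sub>a x\<^sub>b x\<^sub>c\<close>.\<close>

lemma comult_repr_cubic_x:
  assumes "comult_repr scale l n f g"
  shows "(\<Sum>i<n. lin_x (f i) * quad_x (g i)) = (\<Sum>i<n. quad_x (f i) * lin_x (g i))"
proof -
  have l: "(\<Sum>i<n. f i a * g i b) = l (a * b)" for a b
    using assms by (simp add: comult_repr_def)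
  show ?thesis
    by (simp add: lin_x_mult_quad_x quad_x_mult_lin_x sum_cubic_x l mult.assoc)
qed

lemma model_d_lin: "model_d (lin_x l) = lin_y l" "model_d (lin_y l) = 0"
  by (simp_all add: lin_x_def lin_y_def model_d_sum model_d_fconst_mult)

lemma model_d_quad_x:
  assumes "comult_repr scale l n f g"
  shows "model_d (quad_x l) = (\<Sum>i<n. lin_y (f i) * lin_x (g i) - lin_x (f i) * lin_y (g i))"
  using model_d_Leibniz[OF lin_x_graded]
  by (simp add: comult_repr_quad_x[OF assms] model_d_sum model_d_lin fconst_uminus)

text \<open>The differential of the model, transported to the Weil algebra and made extensional.\<close>

definition weil_diff :: "('k, 'a) weil \<Rightarrow> ('k, 'a) weil"
  where "weil_diff = restrict (\<lambda>X. weil_of (model_d (inv_into model weil_of X))) (carrier W)"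

lemma weil_diff_weil_of: "p \<in> model \<Longrightarrow> weil_diff (weil_of p) = weil_of (model_d p)"
  by (simp add: weil_diff_def inv_into_f_f[OF inj_on_weil_of])

lemma in_modelI [intro]: "p \<in> graded_model j \<Longrightarrow> p \<in> model"
  by (rule word_span_graded_subset)

lemma weil_diff_generators:
  assumes "l \<in> dual scale" "comult_repr scale l n f g"
  shows "weil_diff (weil_minus scale l) = weil_plus scale l \<oplus>\<^bsub>W\<^esub>
      (\<Oplus>\<^bsub>W\<^esub>i\<in>{..<n}. weil_minus scale (f i) \<otimes>\<^bsub>W\<^esub> weil_minus scale (g i))"
    and "weil_diff (weil_plus scale l) = (\<Oplus>\<^bsub>W\<^esub>i\<in>{..<n}.
      weil_minus scale (f i) \<otimes>\<^bsub>W\<^esub> weil_plus scale (g i) \<ominus>\<^bsub>W\<^esub>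
      weil_plus scale (f i) \<otimes>\<^bsub>W\<^esub> weil_minus scale (g i))"
proof -
  have fg: "f i \<in> dual scale" "g i \<in> dual scale" if "i < n" for i
    using assms(2) that by (auto simp: comult_repr_def)
  note in_model = word_span_lists_mult word_span_diff word_span_sum
  have "(\<Oplus>\<^bsub>W\<^esub>i\<in>{..<n}. weil_minus scale (f i) \<otimes>\<^bsub>W\<^esub> weil_minus scale (g i)) =
      (\<Oplus>\<^bsub>W\<^esub>i\<in>{..<n}. weil_of (lin_x (f i) * lin_x (g i)))"
    by (rule W.finsum_cong')
      (auto simp: fg weil_minus_eq weil_of_mult intro!: weil_of_in in_model)
  also have "\<dots> = weil_of (quad_x l)"
    by (simp add: weil_of_sum in_model comult_repr_quad_x[OF assms(2)])
  finally show "weil_diff (weil_minus scale l) = weil_plus scale l \<oplus>\<^bsub>W\<^esub>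
      (\<Oplus>\<^bsub>W\<^esub>i\<in>{..<n}. weil_minus scale (f i) \<otimes>\<^bsub>W\<^esub> weil_minus scale (g i))"
    using assms(1)
    by (simp add: weil_minus_eq weil_plus_eq weil_diff_weil_of model_d_lin in_model
        flip: weil_of_add)
  let ?q = "\<lambda>i. lin_x (f i) * (lin_y (g i) - quad_x (g i)) -
    (lin_y (f i) - quad_x (f i)) * lin_x (g i)"
  have "(\<Oplus>\<^bsub>W\<^esub>i\<in>{..<n}. weil_minus scale (f i) \<otimes>\<^bsub>W\<^esub> weil_plus scale (g i) \<ominus>\<^bsub>W\<^esub>
      weil_plus scale (f i) \<otimes>\<^bsub>W\<^esub> weil_minus scale (g i)) = (\<Oplus>\<^bsub>W\<^esub>i\<in>{..<n}. weil_of (?q i))"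
    using fg
    by (intro W.finsum_cong')
      (simp_all add: weil_minus_eq weil_plus_eq weil_of_mult weil_of_diff in_model Pi_iff)
  also have "\<dots> = weil_of (\<Sum>i<n. ?q i)"
    by (simp add: weil_of_sum in_model)
  also have "(\<Sum>i<n. ?q i) = model_d (lin_y l - quad_x l)"
    using comult_repr_cubic_x[OF assms(2)]
    by (simp add: model_d_diff model_d_lin model_d_quad_x[OF assms(2)] right_diff_distrib
        left_diff_distrib sum_subtractf)
  finally show "weil_diff (weil_plus scale l) = (\<Oplus>\<^bsub>W\<^esub>i\<in>{..<n}.
      weil_minus scale (f i) \<otimes>\<^bsub>W\<^esub> weil_plus scale (g i) \<ominus>\<^bsub>W\<^esub>
      weil_plus scale (f i) \<otimes>\<^bsub>W\<^esub> weil_minus scale (g i))"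
    using assms(1) by (simp add: weil_plus_eq weil_diff_weil_of in_model)
qed

lemma is_weil_differential_weil_diff: "is_weil_differential scale weil_diff"
  unfolding is_weil_differential_def Let_def
proof (intro conjI ballI allI impI)
  note in_model = word_span_lists_mult word_span_add word_span_fconst_mult model_d_in_span
  show "weil_diff \<in> carrier W \<rightarrow>\<^sub>E carrier W"
    unfolding weil_diff_def restrict_PiE_iff
    by (auto simp: carrier_weil inv_into_f_f[OF inj_on_weil_of] model_d_in_span)
  fix X Y assume "X \<in> carrier W" "Y \<in> carrier W"
  then show "weil_diff (X \<oplus>\<^bsub>W\<^esub> Y) = weil_diff X \<oplus>\<^bsub>W\<^esub> weil_diff Y"
    by (auto simp: carrier_weil weil_diff_weil_of in_model model_d_add simp flip: weil_of_add)
next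
  fix c X assume "X \<in> carrier W"
  then show "weil_diff (c \<odot>\<^bsub>W\<^esub> X) = c \<odot>\<^bsub>W\<^esub> weil_diff X"
    by (auto simp: carrier_weil weil_diff_weil_of model_d_in_span word_span_fconst_mult
        model_d_fconst_mult simp flip: weil_of_smult)
next
  fix i
  show "weil_diff ` weil_degree scale i \<subseteq> weil_degree scale (Suc i)"
    by (auto simp: weil_degree_eq weil_diff_weil_of[OF in_modelI] intro: model_d_graded)
next
  fix i X Y assume "X \<in> weil_degree scale i" "Y \<in> carrier W"
  then obtain p q where p: "X = weil_of p" "p \<in> graded_model i" and q: "Y = weil_of q" "q \<in> model"
    by (auto simp: carrier_weil weil_degree_eq)
  from p q in_modelI[OF p(2)]
  show "weil_diff (X \<otimes>\<^bsub>W\<^esub> Y) =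
      weil_diff X \<otimes>\<^bsub>W\<^esub> Y \<oplus>\<^bsub>W\<^esub> (- 1) ^ i \<odot>\<^bsub>W\<^esub> (X \<otimes>\<^bsub>W\<^esub> weil_diff Y)"
    by (simp add: weil_diff_weil_of word_span_lists_mult model_d_in_span word_span_fconst_mult
        model_d_Leibniz[OF p(2)] flip: weil_of_mult weil_of_smult weil_of_add)
qed (erule (1) weil_diff_generators)+

text \<open>A derivation is determined by its values on generators. The elements on which \<open>d\<close> agrees with
  the transported differential form a subspace that contains 1 and is stable under left
  multiplication by the homogeneous generators \<open>\<lambda>\<^sub>-\<close> and \<open>\<lambda>\<^sub>+\<close>, hence also by the letters \<open>x\<^sub>b\<close> and
  \<open>y\<^sub>b\<close>; therefore it contains all words.\<close>

lemma is_weil_differential_unique: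
  assumes d: "is_weil_differential scale d"
  shows "d = weil_diff"
proof -
  note d_unfolded = d[unfolded is_weil_differential_def Let_def]
  have d_in: "d \<in> carrier W \<rightarrow>\<^sub>E carrier W"
    by (rule d_unfolded[THEN conjunct1])
  have add: "\<And>X Y. X \<in> carrier W \<Longrightarrow> Y \<in> carrier W \<Longrightarrow> d (X \<oplus>\<^bsub>W\<^esub> Y) = d X \<oplus>\<^bsub>W\<^esub> d Y"
    using d_unfolded[THEN conjunct2, THEN conjunct1] by blast
  have smult: "\<And>c X. X \<in> carrier W \<Longrightarrow> d (c \<odot>\<^bsub>W\<^esub> X) = c \<odot>\<^bsub>W\<^esub> d X"
    using d_unfolded[THEN conjunct2, THEN conjunct2, THEN conjunct1] by blast
  have leibniz: "\<And>i X Y. X \<in> weil_degree scale i \<Longrightarrow> Y \<in> carrier W \<Longrightarrow>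
      d (X \<otimes>\<^bsub>W\<^esub> Y) = d X \<otimes>\<^bsub>W\<^esub> Y \<oplus>\<^bsub>W\<^esub> (- 1) ^ i \<odot>\<^bsub>W\<^esub> (X \<otimes>\<^bsub>W\<^esub> d Y)"
    using d_unfolded[THEN conjunct2, THEN conjunct2, THEN conjunct2, THEN conjunct2, THEN conjunct1] by blast
  have gens: "\<And>l n f g. l \<in> dual scale \<Longrightarrow> comult_repr scale l n f g \<Longrightarrow>
      d (weil_minus scale l) = weil_plus scale l \<oplus>\<^bsub>W\<^esub>
        (\<Oplus>\<^bsub>W\<^esub>i\<in>{..<n}. weil_minus scale (f i) \<otimes>\<^bsub>W\<^esub> weil_minus scale (g i)) \<and>
      d (weil_plus scale l) = (\<Oplus>\<^bsub>W\<^esub>i\<in>{..<n}.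
        weil_minus scale (f i) \<otimes>\<^bsub>W\<^esub> weil_plus scale (g i) \<ominus>\<^bsub>W\<^esub>
        weil_plus scale (f i) \<otimes>\<^bsub>W\<^esub> weil_minus scale (g i))"
    using d_unfolded[THEN conjunct2, THEN conjunct2, THEN conjunct2, THEN conjunct2, THEN conjunct2] by blast
  define S where "S = {p \<in> model. d (weil_of p) = weil_of (model_d p)}"
  have S_model: "p \<in> model" if "p \<in> S" for p
    using that by (simp add: S_def)
  have S_add: "p + q \<in> S" if "p \<in> S" "q \<in> S" for p q
    using that by (simp add: S_def weil_of_add add model_d_add word_span_add model_d_in_span)
  have S_fconst: "fconst c * p \<in> S" if "p \<in> S" for c p
    using that
    by (simp add: S_def weil_of_smult smult model_d_fconst_mult word_span_fconst_mult model_d_in_span)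
  have S_sum: "sum f I \<in> S" if "finite I" "I \<noteq> {}" "\<And>i. i \<in> I \<Longrightarrow> f i \<in> S" for f and I :: "'a set"
    using that by (induction I rule: finite_ne_induct) (simp_all add: S_add)
  have S_mult: "u * p \<in> S" if u: "u \<in> S" "u \<in> graded_model i" and p: "p \<in> S" for u p i
  proof -
    have "d (weil_of u \<otimes>\<^bsub>W\<^esub> weil_of p) = d (weil_of u) \<otimes>\<^bsub>W\<^esub> weil_of p \<oplus>\<^bsub>W\<^esub>
        (- 1) ^ i \<odot>\<^bsub>W\<^esub> (weil_of u \<otimes>\<^bsub>W\<^esub> d (weil_of p))"
      using u p by (intro leibniz) (auto simp: weil_degree_eq S_model)
    with u p show ?thesis
      by (simp add: S_def word_span_lists_mult word_span_fconst_mult model_d_in_span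
          model_d_Leibniz[OF u(2)] flip: weil_of_mult weil_of_smult weil_of_add)
  qed
  have one: "1 \<in> S"
  proof -
    have "1 \<in> graded_model 0"
      by (simp add: one_in_word_span)
    then have "weil_of 1 \<in> weil_degree scale 0" and "1 \<in> model"
      by (auto simp: weil_degree_eq intro: one_in_word_span)
    have "d (weil_of 1) \<in> carrier W"
      using d_in \<open>1 \<in> model\<close> by auto
    then obtain p where p: "p \<in> model" "d (weil_of 1) = weil_of p"
      by (auto simp: carrier_weil)
    have "weil_of 1 \<otimes>\<^bsub>W\<^esub> weil_of 1 = weil_of 1"
      using weil_of_mult[of 1 1] \<open>1 \<in> model\<close> by simp
    moreover have "weil_of p \<otimes>\<^bsub>W\<^esub> weil_of 1 \<oplus>\<^bsub>W\<^esub> (- 1) ^ 0 \<odot>\<^bsub>W\<^esub> (weil_of 1 \<otimes>\<^bsub>W\<^esub> weil_of p) =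
        weil_of (p + p)"
      using weil_of_mult[of p 1] weil_of_mult[of 1 p] weil_of_smult[of p 1] weil_of_add[of p p]
        p \<open>1 \<in> model\<close> by simp
    ultimately have "weil_of p = weil_of (p + p)"
      using leibniz[OF \<open>weil_of 1 \<in> weil_degree scale 0\<close> weil_of_in[OF \<open>1 \<in> model\<close>]] p by simp
    \<comment> \<open>The Leibniz rule for \<open>1 = 1 * 1\<close>, so that \<open>d 1 = 0\<close>.\<close>
    then have "p = p + p"
      using p by (simp add: weil_of_eq_iff word_span_add)
    with p \<open>1 \<in> model\<close> show ?thesis
      by (simp add: S_def)
  qed
  have gen_S: "lin_x l \<in> S" "lin_y l - quad_x l \<in> S" if l: "l \<in> dual scale" for l
  proof -
    obtain n f g where fg: "comult_repr scale l n f g"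
      using comult_repr_exists[OF l] .
    from gens[OF l fg] weil_diff_generators[OF l fg] l
    show "lin_x l \<in> S" "lin_y l - quad_x l \<in> S"
      by (simp_all add: S_def weil_minus_eq[OF l] weil_plus_eq[OF l] weil_diff_weil_of word_span_diff)
  qed
  have lin_coord: "lin_x (coord b) = gen_x b" "lin_y (coord b) = gen_y b" if "b \<in> B" for b
    using that by (simp_all add: lin_x_def lin_y_def sum_delta_fconst)
  have x_mult: "gen_x b * p \<in> S" if "b \<in> B" "p \<in> S" for b p
    using S_mult[OF gen_S(1)[OF coord_in_dual] lin_x_graded that(2), of b] lin_coord[OF that(1)]
    by simp
  \<comment> \<open>\<open>y\<^sub>b\<close> is the sum of the generator \<open>b\<^sup>*\<^sub>+\<close> and a quadratic element in the \<open>x\<^sub>c\<close>.\<close>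
  have y_mult: "gen_y b * p \<in> S" if b: "b \<in> B" and p: "p \<in> S" for b p
  proof -
    have "(lin_y (coord b) - quad_x (coord b)) * p \<in> S"
      using p lin_y_graded quad_x_graded
      by (intro S_mult[of _ 2] gen_S coord_in_dual word_span_diff)
    moreover have "quad_x (coord b) * p \<in> S"
      using b finite_B
      by (auto simp: quad_x_def sum_distrib_right mult.assoc intro!: S_sum S_fconst x_mult p)
    ultimately have "(lin_y (coord b) - quad_x (coord b)) * p + quad_x (coord b) * p \<in> S"
      by (rule S_add)
    with lin_coord[OF b] show ?thesis
      by (simp flip: distrib_right)
  qed
  have "p \<in> S" if "p \<in> model" for p
    using that
  proof (induction rule: word_span_induct)
    case zero
    show ?case
      using S_fconst[OF one, of 0] by simp
  next
    case (single w c)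
    then show ?case
    proof (induction w)
      case Nil
      show ?case
        using S_fconst[OF one, of c] by (simp add: fconst_def)
    next
      case (Cons g w)
      then have "fgen g * Poly_Mapping.single w c \<in> S"
        by (auto simp: letters_def intro: x_mult y_mult)
      then show ?case
        by (simp add: fgen_mult_single)
    qed
  qed (rule S_add)
  then have "d X = weil_diff X" if "X \<in> carrier W" for X
    using that by (auto simp: carrier_weil S_def weil_diff_weil_of)
  then show ?thesis
    using d_in by (intro ext) (auto simp: weil_diff_def PiE_def extensional_def)
qed

lemma weil_d_eq: "weil_d scale = weil_diff"
  unfolding weil_d_def
  by (rule the_equality) (auto intro: is_weil_differential_weil_diff is_weil_differential_unique)

end


section \<open>Cohomology\<close>

lemma (in group) trivial_self_FactGroup: "trivial_group (G Mod carrier G)"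
proof -
  have "carrier G \<lhd> G"
    by (rule normal_invI) (auto simp: subgroup_self)
  then have "group (G Mod carrier G)"
    by (rule normal.factorgroup_is_group)
  moreover have "carrier (G Mod carrier G) = {\<one>\<^bsub>G Mod carrier G\<^esub>}"
    using coset_join2[OF _ subgroup_self] one_closed by (auto simp: carrier_FactGroup)
  ultimately show ?thesis
    by (simp add: trivial_group_def)
qed

context based_algebra
begin

lemma weil_cocycles_eq: "weil_cocycles scale j = weil_of ` {p \<in> graded_model j. model_d p = 0}"
proof -
  have "weil_d scale (weil_of p) = \<zero>\<^bsub>W\<^esub> \<longleftrightarrow> model_d p = 0" if "p \<in> graded_model j" for p
    using in_modelI[OF that] weil_of_eq_iff[of "model_d p" 0]
    by (simp add: weil_d_eq weil_diff_weil_of model_d_in_span flip: weil_of_0)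
  then show ?thesis
    by (auto simp: weil_cocycles_def weil_degree_eq)
qed

lemma weil_coboundaries_Suc:
  "weil_coboundaries scale (Suc i) = weil_of ` model_d ` graded_model i"
  by (auto simp: weil_coboundaries_def weil_degree_eq weil_d_eq weil_diff_weil_of[OF in_modelI]
      image_image)

lemma cocycles_eq_coboundaries: "weil_cocycles scale (Suc i) = weil_coboundaries scale (Suc i)"
proof -
  have "p \<in> model_d ` graded_model i" if "p \<in> graded_model (Suc i)" "model_d p = 0" for p
  proof
    have "[] \<notin> Poly_Mapping.keys p"
      using that(1) by (auto simp: word_span_def)
    with model_homotopy[of p] that(2) show "p = model_d (homotopy p)"
      by (simp add: in_keys_iff)
    show "homotopy p \<in> graded_model i"
      using that(1) by (rule homotopy_graded)
  qed
  then show ?thesis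
    by (auto simp: weil_cocycles_eq weil_coboundaries_Suc model_d_model_d intro: model_d_graded)
qed

lemma weil_cocycles_0: "weil_cocycles scale 0 = range (\<lambda>c. weil_of (fconst c))"
proof -
  have "p \<in> range fconst" if "p \<in> graded_model 0" for p
    using that
  proof (induction rule: word_span_induct)
    case (add p q)
    then show ?case
      by (auto simp flip: fconst_add)
  qed (auto simp: fconst_def intro: range_eqI[of _ _ 0])
  then have "{p \<in> graded_model 0. model_d p = 0} = range fconst"
    by (auto intro: fconst_in_word_span)
  then show ?thesis
    by (simp add: weil_cocycles_eq image_image)
qed

lemma group_weil_cocycles:
  "group (add_monoid (W\<lparr>carrier := weil_cocycles scale j\<rparr>))"
proof -
  have "subgroup (weil_cocycles scale j) (add_monoid W)"
  proof (rule W.add.subgroupI)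
    show "weil_cocycles scale j \<subseteq> carrier W"
      by (auto simp: weil_cocycles_eq intro: weil_of_in)
    show "weil_cocycles scale j \<noteq> {}"
      by (auto simp: weil_cocycles_eq intro: exI[of _ 0])
  next
    fix X assume "X \<in> weil_cocycles scale j"
    then obtain p where p: "X = weil_of p" "p \<in> graded_model j" "model_d p = 0"
      by (auto simp: weil_cocycles_eq)
    then show "\<ominus>\<^bsub>W\<^esub> X \<in> weil_cocycles scale j"
      using model_d_diff[of 0 p] in_modelI[OF p(2)]
      by (auto simp: weil_cocycles_eq word_span_uminus simp flip: weil_of_uminus)
  next
    fix X Y assume "X \<in> weil_cocycles scale j" "Y \<in> weil_cocycles scale j"
    then show "X \<oplus>\<^bsub>W\<^esub> Y \<in> weil_cocycles scale j"
      by (auto simp: weil_cocycles_eq word_span_add model_d_add in_modelI simp flip: weil_of_add)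
  qed
  then have "group ((add_monoid W)\<lparr>carrier := weil_cocycles scale j\<rparr>)"
    using W.add.is_group by (rule subgroup.subgroup_is_group)
  then show ?thesis
    by simp
qed

lemma trivial_weil_cohomology:
  assumes "j > 0"
  shows "trivial_group (weil_cohomology scale j)"
proof -
  let ?G = "add_monoid (W\<lparr>carrier := weil_cocycles scale j\<rparr>)"
  obtain i where "j = Suc i"
    using assms by (cases j) auto
  then have "weil_coboundaries scale j = carrier ?G"
    by (simp add: cocycles_eq_coboundaries)
  then show ?thesis
    unfolding weil_cohomology_def
    using group.trivial_self_FactGroup[OF group_weil_cocycles] by metis
qed

lemma fconst_in_model: "fconst c \<in> model"
  by (simp add: fconst_in_word_span)

text \<open>The only coboundary in degree 0 is zero, so that the classes are singletons.\<close>

lemma weil_cohomology_0: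
  "carrier (weil_cohomology scale 0) = range (\<lambda>c. {weil_of (fconst c)})"
  "{weil_of (fconst c)} \<otimes>\<^bsub>weil_cohomology scale 0\<^esub> {weil_of (fconst c')} =
    {weil_of (fconst (c + c'))}"
  "weil_cohomology_smult scale 0 c {weil_of (fconst c')} = {weil_of (fconst (c * c'))}"
proof -
  have "\<zero>\<^bsub>W\<^esub> \<oplus>\<^bsub>W\<^esub> weil_of (fconst c) = weil_of (fconst c)" for c
    by (simp add: fconst_in_model)
  then show "carrier (weil_cohomology scale 0) = range (\<lambda>c. {weil_of (fconst c)})"
    by (simp add: weil_cohomology_def carrier_FactGroup weil_cocycles_0 weil_coboundaries_def
        r_coset_def image_image)
  show "{weil_of (fconst c)} \<otimes>\<^bsub>weil_cohomology scale 0\<^esub> {weil_of (fconst c')} =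
      {weil_of (fconst (c + c'))}"
    by (simp add: weil_cohomology_def set_mult_def fconst_add weil_of_add fconst_in_model)
  show "weil_cohomology_smult scale 0 c {weil_of (fconst c')} = {weil_of (fconst (c * c'))}"
    by (simp add: weil_cohomology_smult_def weil_coboundaries_def set_add_def set_mult_def
        fconst_mult fconst_in_model word_span_fconst_mult flip: weil_of_smult)
qed

lemma weil_cohomology_0_iso:
  "(\<lambda>c. {weil_of (fconst c)}) \<in> iso field_add_group (weil_cohomology scale 0)"
proof -
  have "inj (\<lambda>c. {weil_of (fconst c)})"
  proof (rule injI)
    fix c c' :: 'k
    assume "{weil_of (fconst c)} = {weil_of (fconst c')}"
    then have "fconst c = (fconst c' :: 'a weil_gen list \<Rightarrow>\<^sub>0 'k)"
      by (simp add: weil_of_eq_iff fconst_in_model)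
    then show "c = c'"
      by (metis fconst_def lookup_single_eq)
  qed
  then show ?thesis
    by (auto simp: iso_def hom_def field_add_group_def bij_betw_def weil_cohomology_0)
qed

end

theorem lemma17p1p2:
  fixes scale :: "'k::{alg_closed_field, field_char_0} \<Rightarrow> 'a::ring \<Rightarrow> 'a"
  assumes "fin_dim_algebra scale"
  shows "(\<exists>\<phi> \<in> iso field_add_group (weil_cohomology scale 0).
            \<forall>c x. \<phi> (c * x) = weil_cohomology_smult scale 0 c (\<phi> x)) \<and>
         (\<forall>j>0. trivial_group (weil_cohomology scale j))"
proof -
  interpret fin_dim_algebra scale
    by (rule assms)
  obtain B0 where B0: "finite B0" "span B0 = UNIV"
    using finite_dimensional by blast
  obtain B where B: "B \<subseteq> B0" "independent B" "B0 \<subseteq> span B"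
    by (rule maximal_independent_subset)
  interpret based_algebra scale B
  proof
    show "finite B"
      using B(1) B0(1) by (rule finite_subset)
    show "span B = UNIV"
      using span_mono[OF B(3)] B0(2) by (auto simp: span_span)
  qed (rule B(2))
  show ?thesis
  proof (intro conjI bexI[OF _ weil_cohomology_0_iso] allI impI)
    show "{weil_of (fconst (c * x))} = weil_cohomology_smult scale 0 c {weil_of (fconst x)}" for c x
      by (simp add: weil_cohomology_0)
  qed (rule trivial_weil_cohomology)
qed

end
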